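(* Let $N=\mathbb S^{2m_1+1}\times\cdots\times\mathbb S^{2m_\ell+1}\subseteq\mathbb{C}_{\mathcal S}$ be a product of standard CR spheres, and let $(\mathfrak g,\lambda)$ be the pair defined by a surjective linear map $\mathbf L\colon\mathfrak t_{\mathcal S}\to\mathfrak h$, where the kernel $\mathfrak g$ of $\mathbf u=d\circ\mathbf L$ acts transversally on $N$ and $(\mathfrak g,\lambda)$ is positive. Then $$G_{\mathbf L}=\frac12\sum_{i\in\mathcal I}\sum_{r\in I_i\cup\{\infty\}}L_{ir}\log|L_{ir}|=\frac12\sum_{i\in\mathcal I}\sum_{r\in I_i}L_{ir}\log\Bigl|\frac{L_{ir}}{L_{i\infty}}\Bigr|$$ is a symplectic potential for the Levi--Kähler metric, where $L_{ir}=\mathbf L(e_{ir})\in\mathfrak h$ is viewed as an affine function on $\mathcal A\subseteq\mathfrak h^*$, and $L_{i\infty}=-\sum_{r\in I_i}L_{ir}$. Equivalently, the reduced metric on the image of the horizontal momentum map $\mu^\lambda$ is given by $$h^{\mathrm{red}}_{\mathbf L}=\frac12\sum_{i\in\mathcal I}\sum_{r\in I_i\cup\{\infty\}}\frac{dL_{ir}^2}{L_{ir}}=\frac12\sum_{i\in\mathcal I}\sum_{0\le r<s\le m_i}\frac{L_{ir}L_{is}}{\sum_{t=0}^{m_i}L_{it}}\Bigl(\frac{dL_{ir}}{L_{ir}}-\frac{dL_{is}}{L_{is}}\Bigr)^2.$$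
   Context: **Set-up.** Fix positive integers $\ell,m_1,\dots,m_\ell$; $m=\sum_im_i$, $\mathcal I=\{1,\dots,\ell\}$, $I_i=\{0,\dots,m_i\}$, $\mathcal S=\{(i,r):i\in\mathcal I,r\in I_i\}$. $\mathbb{C}_{\mathcal S}\cong\prod_i\mathbb{C}^{m_i+1}$ has coordinates $z_{ir}$; $\mathfrak t_{\mathcal S}\cong\mathbb{R}^{m+\ell}$ has basis $e_{ir}$; $\mathbb T_{\mathcal S}=\mathfrak t_{\mathcal S}/2\pi\mathbb Z_{\mathcal S}$ acts diagonally, with induced vector fields $K_v$. With $\sigma_{ir}=\frac12|z_{ir}|^2$, $N=\{z:\sum_{r\in I_i}\sigma_{ir}=1\ \forall i\in\mathcal I\}$, with $\mathcal D=TN\cap J\,TN$ of rank $2m$. **Pairs.** Fix an exact sequence $0\to\mathbb R\xrightarrow{\varepsilon}\mathfrak h\xrightarrow{d}\mathfrak t\to0$ of vector spaces, $\dim\mathfrak t=m$; $\mathcal A=\{\xi\in\mathfrak h^*:\xi(\varepsilon(1))=1\}$; $\mathfrak h$ is the space of affine functions on $\mathcal A$. A surjective linear $\mathbf L\colon\mathfrak t_{\mathcal S}\to\mathfrak h$ defines $\mathfrak g=\ker(d\circ\mathbf L)$ and $\lambda\in\mathfrak g^*\setminus0$ by $\mathbf L(v)=\varepsilon(\lambda(v))$ for $v\in\mathfrak g$. **Levi–Kähler metric.** $\mathfrak g$ acts transversally on $N$ if $TN=\mathcal D\oplus\operatorname{span}\{K_v:v\in\mathfrak g\}$ at every point, with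 second summand of rank $\ell$. Then $\eta\colon TN\to\mathfrak g$ is the 1-form with $\ker\eta=\mathcal D$, $\eta(K_v)=v$ ($v\in\mathfrak g$), $\eta^\lambda=\langle\eta,\lambda\rangle$, and $h_{\mathcal D,\lambda}=d\eta^\lambda|_{\mathcal D}(\cdot,J\cdot)$; $(\mathfrak g,\lambda)$ is positive if this is positive definite, and then $h_{\mathcal D,\lambda}$ is the (horizontal) Levi–Kähler metric. The horizontal momentum map $\mu^\lambda\colon N\to\mathcal A$ is given by $\langle\mu^\lambda(z),\mathbf L(v)\rangle=\eta^\lambda_z(K_v)$ for all $v\in\mathfrak t_{\mathcal S}$. **Reduced metric, symplectic potential.** Let $\mathcal K=\operatorname{span}\{K_v:v\in\mathfrak t_{\mathcal S}\}$. Over the open set of $N$ where all $z_{ir}\neq0$, $TN=\mathcal K\oplus J(\mathcal K\cap\mathcal D)$, and the reduced metric is the metric on the image of this set under $\mu^\lambda$ (an open subset of $\mathcal A$) whose pullback by $\mu^\lambda$ agrees with $h_{\mathcal D,\lambda}$ on $J(\mathcal K\cap\mathcal D)$. A symplectic potential is a function on this open subset of $\mathcal A$ whose Hessian (with respect to the affine structure) is the reduced metric. *)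

theory Defs
  imports "HOL-Analysis.Analysis"
begin

section \<open>Calculus on subsets of a normed space\<close>

definition tangent_space :: "'a::real_normed_vector set \<Rightarrow> 'a \<Rightarrow> 'a set" where
  "tangent_space N z =
     {X. \<exists>\<gamma>::real \<Rightarrow> 'a. \<gamma> 0 = z \<and> (\<forall>t. \<gamma> t \<in> N) \<and> (\<gamma> has_vector_derivative X) (at 0)}"

text \<open>Differential of a map defined on a submanifold \<open>N\<close>. A derivative within \<open>N\<close> is not unique as
  a map on the ambient space, but its value on a tangent vector of \<open>N\<close> is.\<close>

definition diff_on ::
    "'a::real_normed_vector set \<Rightarrow> ('a \<Rightarrow> 'b::real_normed_vector) \<Rightarrow> 'a \<Rightarrow> 'a \<Rightarrow> 'b" where
  "diff_on N f z X = (THE w. \<exists>f'. (f has_derivative f') (at z within N) \<and> w = f' X)"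

text \<open>Exterior derivative at \<open>z\<close> of a 1-form \<open>\<alpha>\<close> on a submanifold \<open>N\<close>, evaluated on tangent
  vectors \<open>X\<close>, \<open>Y\<close>: extend \<open>\<alpha>\<close> to a 1-form \<open>a\<close> on an ambient neighbourhood of \<open>z\<close> and take
  \<open>da(X,Y) = (D\<^sub>X a)(Y) - (D\<^sub>Y a)(X)\<close>; by naturality of \<open>d\<close> the value does not depend on the
  extension. There is no factor 1/2 in this convention, i.e. \<open>(dx \<and> dy)(\<partial>\<^sub>x,\<partial>\<^sub>y) = 1\<close>.\<close>

definition ext_deriv ::
    "'a::real_normed_vector set \<Rightarrow> ('a \<Rightarrow> 'a \<Rightarrow> real) \<Rightarrow> 'a \<Rightarrow> 'a \<Rightarrow> 'a \<Rightarrow> real" where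
  "ext_deriv N \<alpha> z X Y =
     (THE c. \<exists>(a :: 'a \<Rightarrow> 'a \<Rightarrow>\<^sub>L real) a' W.
        open W \<and> z \<in> W \<and>
        (\<forall>w\<in>N \<inter> W. \<forall>V\<in>tangent_space N w. blinfun_apply (a w) V = \<alpha> w V) \<and>
        (a has_derivative a') (at z) \<and>
        c = blinfun_apply (a' X) Y - blinfun_apply (a' Y) X)"

text \<open>Smoothness and Hessians on a relatively open subset \<open>U\<close> of an affine subspace with
  translation space \<open>V\<close>; only values of derivatives on \<open>V\<close> are meaningful.\<close>

primrec Ck_on :: "nat \<Rightarrow> 'a::real_normed_vector set \<Rightarrow> 'a set \<Rightarrow> ('a \<Rightarrow> real) \<Rightarrow> bool" where
  "Ck_on 0 U V f \<longleftrightarrow> continuous_on U f"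
| "Ck_on (Suc k) U V f \<longleftrightarrow>
     (\<exists>f'. (\<forall>\<xi>\<in>U. (f has_derivative f' \<xi>) (at \<xi> within U)) \<and>
           (\<forall>v\<in>V. Ck_on k U V (\<lambda>\<xi>. f' \<xi> v)))"

definition smooth_fun_on :: "'a::real_normed_vector set \<Rightarrow> 'a set \<Rightarrow> ('a \<Rightarrow> real) \<Rightarrow> bool" where
  "smooth_fun_on U V f \<longleftrightarrow> (\<forall>k. Ck_on k U V f)"

definition has_hessian_on ::
    "('a::real_normed_vector \<Rightarrow> real) \<Rightarrow> ('a \<Rightarrow> 'a \<Rightarrow> 'a \<Rightarrow> real) \<Rightarrow> 'a set \<Rightarrow> 'a set \<Rightarrow> bool" where
  "has_hessian_on G Q U V \<longleftrightarrow>
     (\<exists>G' G''. \<forall>\<xi>\<in>U.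
        (G has_derivative G' \<xi>) (at \<xi> within U) \<and>
        (\<forall>v\<in>V. ((\<lambda>\<zeta>. G' \<zeta> v) has_derivative G'' \<xi> v) (at \<xi> within U) \<and>
               (\<forall>u\<in>V. G'' \<xi> v u = Q \<xi> u v)))"

definition riemannian_metric_on ::
    "'a::real_normed_vector set \<Rightarrow> 'a set \<Rightarrow> ('a \<Rightarrow> 'a \<Rightarrow> 'a \<Rightarrow> real) \<Rightarrow> bool" where
  "riemannian_metric_on U V Q \<longleftrightarrow>
     (\<forall>\<xi>\<in>U.
        (\<forall>u\<in>V. \<forall>v\<in>V. Q \<xi> u v = Q \<xi> v u) \<and>
        (\<forall>u\<in>V. \<forall>v\<in>V. \<forall>w\<in>V. Q \<xi> (u + v) w = Q \<xi> u w + Q \<xi> v w) \<and>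
        (\<forall>c. \<forall>u\<in>V. \<forall>w\<in>V. Q \<xi> (c *\<^sub>R u) w = c * Q \<xi> u w) \<and>
        (\<forall>u\<in>V. u \<noteq> 0 \<longrightarrow> Q \<xi> u u > 0)) \<and>
     (\<forall>u\<in>V. \<forall>v\<in>V. smooth_fun_on U V (\<lambda>\<xi>. Q \<xi> u v))"


section \<open>Products of CR spheres and the torus action\<close>

text \<open>The coordinates of \<open>complex ^ 's\<close> and \<open>real ^ 's\<close> are labelled by the pairs \<open>(i,r)\<close> with
  \<open>i \<in> {1..l}\<close> and \<open>r \<in> {0..m i}\<close> through a bijection \<open>idx\<close> of the set of these pairs with the
  index type \<open>'s\<close>.\<close>

definition pair_index :: "nat \<Rightarrow> (nat \<Rightarrow> nat) \<Rightarrow> (nat \<times> nat \<Rightarrow> 's) \<Rightarrow> bool" where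
  "pair_index l m idx \<longleftrightarrow> bij_betw idx (SIGMA i:{1..l}. {0..m i}) UNIV"

definition sphere_product ::
    "nat \<Rightarrow> (nat \<Rightarrow> nat) \<Rightarrow> (nat \<times> nat \<Rightarrow> 's::finite) \<Rightarrow> (complex ^ 's) set" where
  "sphere_product l m idx =
     {z. \<forall>i\<in>{1..l}. (\<Sum>r\<in>{0..m i}. (1/2) * (cmod (z $ idx (i, r)))\<^sup>2) = 1}"

definition Jmap :: "complex ^ 's \<Rightarrow> complex ^ 's::finite" where
  "Jmap X = \<i> *s X"

definition cr_dist :: "(complex ^ 's::finite) set \<Rightarrow> complex ^ 's \<Rightarrow> (complex ^ 's) set" where
  "cr_dist N z = tangent_space N z \<inter> Jmap ` tangent_space N z"

definition torus_act :: "real ^ 's \<Rightarrow> complex ^ 's \<Rightarrow> complex ^ 's::finite" where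
  "torus_act v z = (\<chi> s. cis (v $ s) * z $ s)"

definition gen_field :: "real ^ 's \<Rightarrow> complex ^ 's \<Rightarrow> complex ^ 's::finite" where
  "gen_field v z = vector_derivative (\<lambda>t. torus_act (t *\<^sub>R v) z) (at 0)"


section \<open>Pairs and Levi--Kaehler metrics\<close>

definition pair_g :: "('h::euclidean_space \<Rightarrow> 't::euclidean_space) \<Rightarrow> (real ^ 's \<Rightarrow> 'h) \<Rightarrow> (real ^ 's::finite) set" where
  "pair_g d L = {v. d (L v) = 0}"

definition pair_lam :: "(real \<Rightarrow> 'h::euclidean_space) \<Rightarrow> (real ^ 's \<Rightarrow> 'h) \<Rightarrow> real ^ 's::finite \<Rightarrow> real" where
  "pair_lam \<epsilon> L v = (THE c. L v = \<epsilon> c)"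

definition acts_transversally ::
    "(complex ^ 's::finite) set \<Rightarrow> (real ^ 's) set \<Rightarrow> nat \<Rightarrow> bool" where
  "acts_transversally N g l \<longleftrightarrow>
     (\<forall>z\<in>N.
        let D = cr_dist N z; R = span ((\<lambda>v. gen_field v z) ` g) in
          tangent_space N z = {X + Y | X Y. X \<in> D \<and> Y \<in> R} \<and> D \<inter> R = {0} \<and> dim R = l)"

text \<open>Under transversality \<open>\<eta>\<close> is the projection of \<open>TN\<close> along \<open>\<D>\<close> onto the span of the \<open>K\<^sub>v\<close>,
  \<open>v \<in> g\<close>, composed with the inverse of \<open>v \<mapsto> K\<^sub>v\<close>.\<close>

definition eta ::
    "(complex ^ 's::finite) set \<Rightarrow> (real ^ 's) set \<Rightarrow> complex ^ 's \<Rightarrow> complex ^ 's \<Rightarrow> real ^ 's" where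
  "eta N g z X = (THE v. v \<in> g \<and> X - gen_field v z \<in> cr_dist N z)"

definition eta_lam ::
    "(complex ^ 's::finite) set \<Rightarrow> (real ^ 's) set \<Rightarrow> (real ^ 's \<Rightarrow> real) \<Rightarrow>
     complex ^ 's \<Rightarrow> complex ^ 's \<Rightarrow> real" where
  "eta_lam N g lam z X = lam (eta N g z X)"

definition levi_kaehler ::
    "(complex ^ 's::finite) set \<Rightarrow> (real ^ 's) set \<Rightarrow> (real ^ 's \<Rightarrow> real) \<Rightarrow>
     complex ^ 's \<Rightarrow> complex ^ 's \<Rightarrow> complex ^ 's \<Rightarrow> real" where
  "levi_kaehler N g lam z X Y = ext_deriv N (eta_lam N g lam) z X (Jmap Y)"

definition positive_pair ::
    "(complex ^ 's::finite) set \<Rightarrow> (real ^ 's) set \<Rightarrow> (real ^ 's \<Rightarrow> real) \<Rightarrow> bool" where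
  "positive_pair N g lam \<longleftrightarrow>
     (\<forall>z\<in>N. \<forall>X\<in>cr_dist N z. X \<noteq> 0 \<longrightarrow> levi_kaehler N g lam z X X > 0)"

definition affine_A :: "(real \<Rightarrow> 'h::euclidean_space) \<Rightarrow> ('h \<Rightarrow>\<^sub>L real) set" where
  "affine_A \<epsilon> = {\<xi>. blinfun_apply \<xi> (\<epsilon> 1) = 1}"

definition trans_A :: "(real \<Rightarrow> 'h::euclidean_space) \<Rightarrow> ('h \<Rightarrow>\<^sub>L real) set" where
  "trans_A \<epsilon> = {u. blinfun_apply u (\<epsilon> 1) = 0}"

definition hmomentum ::
    "(complex ^ 's::finite) set \<Rightarrow> (real ^ 's) set \<Rightarrow> (real ^ 's \<Rightarrow> real) \<Rightarrow>
     (real ^ 's \<Rightarrow> 'h::euclidean_space) \<Rightarrow> complex ^ 's \<Rightarrow> 'h \<Rightarrow>\<^sub>L real" where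
  "hmomentum N g lam L z =
     (THE \<xi>. \<forall>v. blinfun_apply \<xi> (L v) = eta_lam N g lam z (gen_field v z))"

definition generic_part :: "(complex ^ 's::finite) set \<Rightarrow> (complex ^ 's) set" where
  "generic_part N = {z\<in>N. \<forall>s. z $ s \<noteq> 0}"

definition hmomentum_image ::
    "(complex ^ 's::finite) set \<Rightarrow> (real ^ 's) set \<Rightarrow> (real ^ 's \<Rightarrow> real) \<Rightarrow>
     (real ^ 's \<Rightarrow> 'h::euclidean_space) \<Rightarrow> ('h \<Rightarrow>\<^sub>L real) set" where
  "hmomentum_image N g lam L = hmomentum N g lam L ` generic_part N"

definition J_orbit_dist :: "(complex ^ 's::finite) set \<Rightarrow> complex ^ 's \<Rightarrow> (complex ^ 's) set" where
  "J_orbit_dist N z = Jmap ` (span (range (\<lambda>v. gen_field v z)) \<inter> cr_dist N z)"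

definition is_reduced_metric ::
    "(complex ^ 's::finite) set \<Rightarrow> (real ^ 's) set \<Rightarrow> (real ^ 's \<Rightarrow> real) \<Rightarrow>
     (real \<Rightarrow> 'h::euclidean_space) \<Rightarrow> (real ^ 's \<Rightarrow> 'h) \<Rightarrow>
     (('h \<Rightarrow>\<^sub>L real) \<Rightarrow> ('h \<Rightarrow>\<^sub>L real) \<Rightarrow> ('h \<Rightarrow>\<^sub>L real) \<Rightarrow> real) \<Rightarrow> bool" where
  "is_reduced_metric N g lam \<epsilon> L Q \<longleftrightarrow>
     openin (top_of_set (affine_A \<epsilon>)) (hmomentum_image N g lam L) \<and>
     riemannian_metric_on (hmomentum_image N g lam L) (trans_A \<epsilon>) Q \<and>
     (\<forall>z\<in>generic_part N. \<forall>X\<in>J_orbit_dist N z. \<forall>Y\<in>J_orbit_dist N z.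
        Q (hmomentum N g lam L z)
          (diff_on N (hmomentum N g lam L) z X) (diff_on N (hmomentum N g lam L) z Y)
        = levi_kaehler N g lam z X Y)"

definition symplectic_potential ::
    "(complex ^ 's::finite) set \<Rightarrow> (real ^ 's) set \<Rightarrow> (real ^ 's \<Rightarrow> real) \<Rightarrow>
     (real \<Rightarrow> 'h::euclidean_space) \<Rightarrow> (real ^ 's \<Rightarrow> 'h) \<Rightarrow> (('h \<Rightarrow>\<^sub>L real) \<Rightarrow> real) \<Rightarrow> bool" where
  "symplectic_potential N g lam \<epsilon> L G \<longleftrightarrow>
     (\<exists>Q. is_reduced_metric N g lam \<epsilon> L Q \<and>
          has_hessian_on G Q (hmomentum_image N g lam L) (trans_A \<epsilon>))"


section \<open>The functions \<open>L\<^sub>i\<^sub>r\<close> and the potential\<close>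

text \<open>The index set \<open>I\<^sub>i \<union> {\<infinity>}\<close> is realised inside \<^typ>\<open>enat\<close>.\<close>

definition Lvec ::
    "(real ^ 's::finite \<Rightarrow> 'h::euclidean_space) \<Rightarrow> (nat \<Rightarrow> nat) \<Rightarrow> (nat \<times> nat \<Rightarrow> 's) \<Rightarrow> nat \<Rightarrow> enat \<Rightarrow> 'h" where
  "Lvec L m idx i r =
     (case r of enat k \<Rightarrow> L (axis (idx (i, k)) 1)
              | \<infinity> \<Rightarrow> - (\<Sum>k\<in>{0..m i}. L (axis (idx (i, k)) 1)))"

definition G_pot ::
    "(real ^ 's::finite \<Rightarrow> 'h::euclidean_space) \<Rightarrow> nat \<Rightarrow> (nat \<Rightarrow> nat) \<Rightarrow> (nat \<times> nat \<Rightarrow> 's) \<Rightarrow>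
     ('h \<Rightarrow>\<^sub>L real) \<Rightarrow> real" where
  "G_pot L l m idx \<xi> =
     (1/2) * (\<Sum>i\<in>{1..l}. \<Sum>r\<in>insert \<infinity> (enat ` {0..m i}).
        blinfun_apply \<xi> (Lvec L m idx i r) * ln \<bar>blinfun_apply \<xi> (Lvec L m idx i r)\<bar>)"

text \<open>The differential of the affine function \<open>\<xi> \<mapsto> \<xi>(w)\<close> is \<open>u \<mapsto> u(w)\<close>, so the quadratic
  differential \<open>dL\<^sup>2\<close> of the affine function given by \<open>w\<close> polarises to \<open>(u,v) \<mapsto> u(w) v(w)\<close>.\<close>

definition h_red ::
    "(real ^ 's::finite \<Rightarrow> 'h::euclidean_space) \<Rightarrow> nat \<Rightarrow> (nat \<Rightarrow> nat) \<Rightarrow> (nat \<times> nat \<Rightarrow> 's) \<Rightarrow>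
     ('h \<Rightarrow>\<^sub>L real) \<Rightarrow> ('h \<Rightarrow>\<^sub>L real) \<Rightarrow> ('h \<Rightarrow>\<^sub>L real) \<Rightarrow> real" where
  "h_red L l m idx \<xi> u v =
     (1/2) * (\<Sum>i\<in>{1..l}. \<Sum>r\<in>insert \<infinity> (enat ` {0..m i}).
        blinfun_apply u (Lvec L m idx i r) * blinfun_apply v (Lvec L m idx i r)
        / blinfun_apply \<xi> (Lvec L m idx i r))"

end

(* Write sigma_ir = |z_ir|^2 / 2. On N one has eta^lambda = sum_i c_i Im<z_i, .>, where the functions c_i
   are determined by sum_i c_i sum_r |z_ir|^2 v_ir = lambda(v) for v in g. On D the derivatives of the c_i
   do not contribute, so h_{D,lambda} = 2 sum_i c_i Re<., .>_i, and positivity means c_i > 0. The momentum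
   map satisfies L_ir = 2 c_i sigma_ir, hence L_i,infinity = -2 c_i, and its image is the set where all
   L_ir are positive. In J(K cap D) the vectors are X = (x_ir z_ir) with x real and
   sum_r sigma_ir x_ir = 0; along such X one has dL_ir = L_ir (p_i + 2 x_ir) with p_i = d(log c_i)(X),
   and substituting this in the formula for h^red, the terms with p_i cancel against the
   one with r = infinity. *)
theory Submission
  imports Defs
begin

section \<open>Calculus and linear algebra\<close>

text \<open>\<open>eta\<close>, \<open>ext_deriv\<close>, \<open>hmomentum\<close> and
  \<open>diff_on\<close> are definite descriptions, so every formula for them needs existence as
  well as uniqueness. This shapes the treatment of \<open>ext_deriv\<close>: a competing extension
  of the 1-form is arbitrary on vectors normal to \<open>N\<close>, and existence requires
  coefficients c_i that are differentiable on the ambient space, although only their values on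
  \<open>N\<close> are determined. They come from Cramer's rule for a square matrix acting on all of
  \<open>real^'s\<close>, since \<open>g\<close> carries no coordinates of its own. Uniqueness of
  the reduced metric requires that the differential of the momentum map sends J(K cap D) onto all of
  \<open>trans_A\<close>. The numbers p_i need not be computed for this: a covector in
  \<open>trans_A\<close> whose values on the L_ir are the weights times a function of i alone is 0
  by transversality, and this absorbs the unknown p_i. The last form of h^red is Lagrange's identity
  with weights L_ir.\<close>

lemma has_vector_derivative_vec_lambda:
  fixes f :: "'n::finite \<Rightarrow> real \<Rightarrow> 'a::euclidean_space"
  assumes "\<And>i. (f i has_vector_derivative f' i) (at x within S)"
  shows "((\<lambda>t. \<chi> i. f i t) has_vector_derivative (\<chi> i. f' i)) (at x within S)"
  unfolding has_vector_derivative_def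
proof (subst has_derivative_componentwise_within, intro ballI)
  fix b :: "'a^'n" assume "b \<in> Basis"
  then obtain i c where b: "b = axis i c" "c \<in> Basis" by (auto simp: Basis_vec_def)
  have "((\<lambda>t. f i t \<bullet> c) has_derivative (\<lambda>t. (t *\<^sub>R f' i) \<bullet> c)) (at x within S)"
    using assms[of i] unfolding has_vector_derivative_def
    by (intro has_derivative_inner_left)
  then show "((\<lambda>t. (\<chi> i. f i t) \<bullet> b) has_derivative (\<lambda>t. (t *\<^sub>R (\<chi> i. f' i)) \<bullet> b)) (at x within S)"
    by (simp add: b inner_axis)
qed

section \<open>Derivatives within a subset, evaluated on tangent vectors\<close>

lemma vector_derivative_along_tangent_curve:
  fixes f :: "'a::real_normed_vector \<Rightarrow> 'b::real_normed_vector"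
  assumes "\<gamma> (0::real) = z" "\<And>t. \<gamma> t \<in> N" "(\<gamma> has_vector_derivative X) (at 0)"
    and "(f has_derivative f') (at z within N)"
  shows "((\<lambda>t. f (\<gamma> t)) has_vector_derivative f' X) (at 0)"
proof -
  have "(f has_derivative f') (at (\<gamma> 0) within range \<gamma>)"
    using assms by (auto intro: has_derivative_subset)
  from vector_derivative_diff_chain_within[OF _ this] assms(3) show ?thesis
    by (simp add: o_def)
qed

text \<open>Composed with a curve in \<open>N\<close> of velocity \<open>X\<close>, both maps become
  the same function of t near 0, and its velocity is \<open>f' X\<close> as well as
  \<open>h' X\<close>. Identities valid only on \<open>N\<close> are differentiated through this
  lemma; the neighbourhood \<open>W\<close> serves extensions of a 1-form, which agree with it only
  locally.\<close>

lemma derivative_unique_on_tangent_space: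
  fixes f h :: "'a::real_normed_vector \<Rightarrow> 'b::real_normed_vector"
  assumes "X \<in> tangent_space N z" "open W" "z \<in> W"
    and eq: "\<And>w. w \<in> N \<inter> W \<Longrightarrow> f w = h w"
    and f: "(f has_derivative f') (at z within N)" and h: "(h has_derivative h') (at z within N)"
  shows "f' X = h' X"
proof -
  obtain \<gamma> where \<gamma>: "\<gamma> (0::real) = z" "\<And>t. \<gamma> t \<in> N" "(\<gamma> has_vector_derivative X) (at 0)"
    using assms(1) by (auto simp: tangent_space_def)
  have ev: "\<forall>\<^sub>F t in nhds 0. \<gamma> t \<in> W"
  proof -
    have "isCont \<gamma> 0" using \<gamma>(3) has_vector_derivative_continuous by blast
    then have "\<forall>\<^sub>F t in at 0. \<gamma> t \<in> W" using assms(2,3) \<gamma>(1)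
      by (simp add: isCont_def topological_tendstoD)
    then show ?thesis using \<gamma>(1) assms(3) by (simp add: eventually_nhds_conv_at)
  qed
  have "((\<lambda>t. f (\<gamma> t)) has_vector_derivative f' X) (at 0)"
    by (rule vector_derivative_along_tangent_curve[OF \<gamma> f])
  moreover have "((\<lambda>t. h (\<gamma> t)) has_vector_derivative h' X) (at 0)"
    by (rule vector_derivative_along_tangent_curve[OF \<gamma> h])
  moreover have "\<forall>\<^sub>F t in nhds 0. f (\<gamma> t) = h (\<gamma> t)"
    using ev by eventually_elim (use eq \<gamma>(2) in auto)
  ultimately show ?thesis
    using has_vector_derivative_cong_ev[where f="\<lambda>t. f (\<gamma> t)" and g="\<lambda>t. h (\<gamma> t)" and x=0 and S=UNIV and f'="f' X"]
      vector_derivative_unique_at[where f="\<lambda>t. h (\<gamma> t)"] eq[of z] \<gamma>(1) \<gamma>(2)[of 0] assms(3)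
    by (auto elim: eventually_mono)
qed

lemma diff_on_eq:
  assumes "X \<in> tangent_space N z" "(f has_derivative f') (at z within N)"
  shows "diff_on N f z X = f' X"
  unfolding diff_on_def
proof (rule the_equality)
  fix w assume "\<exists>f'. (f has_derivative f') (at z within N) \<and> w = f' X"
  then show "w = f' X"
    using derivative_unique_on_tangent_space[OF assms(1) open_UNIV UNIV_I _ _ assms(2)] by blast
qed (use assms in blast)

section \<open>Dimension counts and determinants\<close>

text \<open>A basis of \<open>S\<close> maps onto a spanning set of the image that has no room for
  coincidences or relations. Applied to v -> K_v on \<open>g\<close>, this turns the rank in the
  transversality condition into injectivity.\<close>

lemma inj_on_if_dim_image_eq:
  fixes f :: "'a::euclidean_space \<Rightarrow> 'b::euclidean_space"
  assumes "linear f" "subspace S" "dim (f ` S) = dim S"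
  shows "inj_on f S"
proof -
  obtain B where B: "B \<subseteq> S" "independent B" "S \<subseteq> span B" "card B = dim S"
    using basis_exists[of S] by auto
  have fB: "finite B" using B(2) independent_bound by blast
  have sp: "span B = S" using B assms(2) by (simp add: span_minimal subset_antisym)
  have spf: "f ` S = span (f ` B)" using sp linear_span_image[OF assms(1)] by metis
  have "card (f ` B) \<le> card B" using fB by (rule card_image_le)
  moreover have "dim (f ` S) \<le> card (f ` B)"
    by (simp add: spf dim_le_card' fB)
  ultimately have c: "card (f ` B) = card B" using B(4) assms(3) by simp
  then have "inj_on f B" using fB eq_card_imp_inj_on by blast
  moreover have "independent (f ` B)"
    by (rule card_le_dim_spanning[where V="f ` S"]) (use spf fB c B assms in \<open>auto simp: span_superset\<close>)
  ultimately show ?thesis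
    using linear_inj_on_span_iff_independent_image[OF assms(1), of B] sp by simp
qed

text \<open>The range of a linear right inverse is a complement of the kernel. The purpose is that
  \<open>g\<close> has dimension l.\<close>

lemma dim_kernel_of_surj:
  fixes f :: "'a::euclidean_space \<Rightarrow> 'b::euclidean_space"
  assumes "linear f" "surj f"
  shows "dim {x. f x = 0} + DIM('b) = DIM('a)"
proof -
  obtain k where k: "linear k" "f \<circ> k = id"
    using linear_surjective_right_inverse[OF assms] by blast
  have fk: "f (k y) = y" for y using k(2) by (metis comp_apply id_apply)
  have 1: "subspace {x. f x = 0}" using assms(1) by (rule linear_subspace_kernel)
  have 2: "subspace (range k)" using k(1) linear_subspace_image subspace_UNIV by blast
  have "inj k" using fk by (metis injI)
  then have 3: "dim (range k) = DIM('b)"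
    using dim_image_eq[OF k(1), of UNIV] by simp
  have "{x + y |x y. x \<in> {x. f x = 0} \<and> y \<in> range k} = UNIV"
  proof -
    have "x = (x - k (f x)) + k (f x)" "f (x - k (f x)) = 0" for x
      using linear_diff[OF assms(1)] fk by auto
    then show ?thesis by fast
  qed
  moreover have "{x. f x = 0} \<inter> range k = {0}"
  proof -
    have "x = 0" if "f x = 0" "x = k y" for x y
      using that fk[of y] linear_0[OF k(1)] by simp
    then show ?thesis using linear_0[OF assms(1)] linear_0[OF k(1)] by (auto simp: image_iff intro!: exI[of _ 0])
  qed
  ultimately show ?thesis using dim_sums_Int[OF 1 2] 3 by simp
qed

lemma differentiable_det:
  fixes A :: "'a::real_normed_vector \<Rightarrow> real^'n^'n"
  assumes "\<And>i j. (\<lambda>w. A w $ i $ j) differentiable (at x within S)"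
  shows "(\<lambda>w. det (A w)) differentiable (at x within S)"
proof -
  have "(\<lambda>w. \<Prod>i\<in>UNIV. A w $ i $ p i) differentiable (at x within S)" for p
    by (rule differentiableI, rule has_derivative_prod, rule assms[unfolded frechet_derivative_works])
  then show ?thesis
    unfolding det_def by (intro differentiable_sum ballI differentiable_mult differentiable_const finite_permutations finite)
qed

section \<open>Smooth functions and Hessians on open subsets of an affine subspace\<close>

lemma Ck_on_add: "Ck_on k U V f \<Longrightarrow> Ck_on k U V h \<Longrightarrow> Ck_on k U V (\<lambda>\<xi>. f \<xi> + h \<xi>)"
proof (induction k arbitrary: f h)
  case 0
  then show ?case by (simp add: continuous_on_add)
next
  case (Suc k)
  obtain f' h' where "\<forall>\<xi>\<in>U. (f has_derivative f' \<xi>) (at \<xi> within U)" "\<forall>v\<in>V. Ck_on k U V (\<lambda>\<xi>. f' \<xi> v)"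
    "\<forall>\<xi>\<in>U. (h has_derivative h' \<xi>) (at \<xi> within U)" "\<forall>v\<in>V. Ck_on k U V (\<lambda>\<xi>. h' \<xi> v)"
    using Suc.prems by auto
  then show ?case
    using Suc.IH by (auto intro!: exI[of _ "\<lambda>\<xi> v. f' \<xi> v + h' \<xi> v"] has_derivative_add)
qed

lemma Ck_on_zero: "Ck_on k U V (\<lambda>\<xi>. 0)"
  by (induction k) (auto intro!: exI[of _ "\<lambda>\<xi> v. 0"])

lemma Ck_on_sum: "(\<And>t. t \<in> T \<Longrightarrow> Ck_on k U V (f t)) \<Longrightarrow> Ck_on k U V (\<lambda>\<xi>. \<Sum>t\<in>T. f t \<xi>)"
  by (induction T rule: infinite_finite_induct) (auto intro: Ck_on_add Ck_on_zero)

text \<open>Differentiation in a direction \<open>v\<close> preserves the shape: the exponent grows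
  by one and the constant picks up a factor. Hence the induction on \<open>k\<close> leaves
  \<open>c\<close> and \<open>n\<close> free.\<close>

lemma Ck_on_inverse_power:
  fixes U :: "('a::real_normed_vector \<Rightarrow>\<^sub>L real) set"
  assumes "\<And>\<xi>. \<xi> \<in> U \<Longrightarrow> blinfun_apply \<xi> w \<noteq> 0"
  shows "Ck_on k U V (\<lambda>\<xi>. c * inverse (blinfun_apply \<xi> w) ^ n)"
proof (induction k arbitrary: c n)
  case 0
  then show ?case using assms by (auto intro!: continuous_intros)
next
  case (Suc k)
  have "((\<lambda>\<xi>. c * inverse (blinfun_apply \<xi> w) ^ n) has_derivative
      (\<lambda>v. - c * real n * blinfun_apply v w * inverse (blinfun_apply \<xi> w) ^ Suc n)) (at \<xi> within U)"
    if "\<xi> \<in> U" for \<xi>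
  proof -
    have "((\<lambda>x::real. c * inverse x ^ n) has_real_derivative
        - c * real n * inverse x ^ Suc n) (at x)" if "x \<noteq> 0" for x
    proof -
      have "((\<lambda>x. c * inverse x ^ n) has_real_derivative
          c * (of_nat n * (- (inverse x ^ Suc (Suc 0)) * inverse x ^ (n - Suc 0)))) (at x)"
        by (intro DERIV_cmult DERIV_power DERIV_inverse that)
      then show ?thesis by (cases n) (simp_all add: mult_ac)
    qed
    from DERIV_compose_FDERIV[where f="\<lambda>x. c * inverse x ^ n" and g="\<lambda>\<xi>. blinfun_apply \<xi> w"
        and g'="\<lambda>v. blinfun_apply v w" and s=U, OF this[OF assms[OF \<open>\<xi> \<in> U\<close>]]]
    show ?thesis
      by (simp add: bounded_linear_imp_has_derivative blinfun.bounded_linear_left mult_ac)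
  qed
  then show ?case
    using Suc.IH by (auto intro!: exI[of _ "\<lambda>\<xi> v. - c * real n * blinfun_apply v w * inverse (blinfun_apply \<xi> w) ^ Suc n"]
        simp del: power_Suc)
qed

lemma has_hessian_on_sum:
  assumes "\<And>t. t \<in> T \<Longrightarrow> has_hessian_on (f t) (Q t) U V"
  shows "has_hessian_on (\<lambda>\<xi>. \<Sum>t\<in>T. f t \<xi>) (\<lambda>\<xi> u v. \<Sum>t\<in>T. Q t \<xi> u v) U V"
proof -
  obtain G' G'' where *: "\<And>t \<xi>. t \<in> T \<Longrightarrow> \<xi> \<in> U \<Longrightarrow>
      (f t has_derivative G' t \<xi>) (at \<xi> within U) \<and>
      (\<forall>v\<in>V. ((\<lambda>\<zeta>. G' t \<zeta> v) has_derivative G'' t \<xi> v) (at \<xi> within U) \<and> (\<forall>u\<in>V. G'' t \<xi> v u = Q t \<xi> u v))"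
    using assms unfolding has_hessian_on_def by metis
  show ?thesis
    unfolding has_hessian_on_def using *
    by (intro exI[of _ "\<lambda>\<xi> v. \<Sum>t\<in>T. G' t \<xi> v"] exI[of _ "\<lambda>\<xi> v u. \<Sum>t\<in>T. G'' t \<xi> v u"])
      (auto intro!: has_derivative_sum sum.cong)
qed

lemma has_hessian_on_cmult:
  assumes "has_hessian_on f Q U V"
  shows "has_hessian_on (\<lambda>\<xi>. c * f \<xi>) (\<lambda>\<xi> u v. c * Q \<xi> u v) U V"
proof -
  obtain G' G'' where *: "\<And>\<xi>. \<xi> \<in> U \<Longrightarrow>
      (f has_derivative G' \<xi>) (at \<xi> within U) \<and>
      (\<forall>v\<in>V. ((\<lambda>\<zeta>. G' \<zeta> v) has_derivative G'' \<xi> v) (at \<xi> within U) \<and> (\<forall>u\<in>V. G'' \<xi> v u = Q \<xi> u v))"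
    using assms unfolding has_hessian_on_def by metis
  show ?thesis
    unfolding has_hessian_on_def using *
    by (intro exI[of _ "\<lambda>\<xi> v. c * G' \<xi> v"] exI[of _ "\<lambda>\<xi> v u. c * G'' \<xi> v u"])
      (auto intro!: has_derivative_mult_right)
qed

lemma has_hessian_on_x_ln_abs_x:
  fixes U :: "('a::real_normed_vector \<Rightarrow>\<^sub>L real) set"
  assumes "\<And>\<xi>. \<xi> \<in> U \<Longrightarrow> blinfun_apply \<xi> w \<noteq> 0"
  shows "has_hessian_on (\<lambda>\<xi>. blinfun_apply \<xi> w * ln \<bar>blinfun_apply \<xi> w\<bar>)
    (\<lambda>\<xi> u v. blinfun_apply u w * blinfun_apply v w / blinfun_apply \<xi> w) U V"
  unfolding has_hessian_on_def
proof (intro exI ballI conjI)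
  fix \<xi> assume "\<xi> \<in> U"
  then have nz: "blinfun_apply \<xi> w \<noteq> 0" by (rule assms)
  \<comment> \<open>The real logarithm is an even function here, so its derivative is 1/x on both
    sides of 0. Negative arguments do occur: L_i,infinity is negative on the image.\<close>
  have ln_abs: "ln \<bar>x\<bar> = ln x" for x :: real by (simp add: abs_if ln_minus)
  have d: "((\<lambda>\<xi>. blinfun_apply \<xi> w) has_derivative (\<lambda>v. blinfun_apply v w)) (at \<xi> within U)"
    by (simp add: bounded_linear_imp_has_derivative blinfun.bounded_linear_left)
  have dln: "(ln has_real_derivative 1 / x) (at x)" if "x \<noteq> 0" for x :: real
  proof (cases "x > 0")
    case False
    then have "((\<lambda>y. ln (- y)) has_real_derivative 1 / x) (at x)"
      using DERIV_chain2[OF DERIV_ln_divide DERIV_minus[OF DERIV_ident], of x] that by simp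
    then show ?thesis by (simp only: ln_minus)
  next
    case True
    then show ?thesis by (rule DERIV_ln_divide)
  qed
  have "((\<lambda>x. x * ln \<bar>x\<bar>) has_real_derivative (ln \<bar>x\<bar> + 1)) (at x)" if "x \<noteq> 0" for x :: real
    unfolding ln_abs using DERIV_mult[OF DERIV_ident dln[OF that]] that by (simp add: add.commute)
  from DERIV_compose_FDERIV[OF this[OF nz] d]
  show "((\<lambda>\<xi>. blinfun_apply \<xi> w * ln \<bar>blinfun_apply \<xi> w\<bar>) has_derivative
      (\<lambda>\<xi> v. blinfun_apply v w * (ln \<bar>blinfun_apply \<xi> w\<bar> + 1)) \<xi>) (at \<xi> within U)" by simp
  fix v
  have "((\<lambda>x. b * (ln \<bar>x\<bar> + 1)) has_real_derivative (b * (1 / x))) (at x)" if "x \<noteq> 0" for b x :: real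
    unfolding ln_abs using DERIV_cmult[OF DERIV_add[OF dln[OF that] DERIV_const[of 1]], of b] by simp
  from DERIV_compose_FDERIV[OF this[OF nz] d]
  show "((\<lambda>\<zeta>. (\<lambda>\<xi> v. blinfun_apply v w * (ln \<bar>blinfun_apply \<xi> w\<bar> + 1)) \<zeta> v) has_derivative
      (\<lambda>\<xi> v u. blinfun_apply u w * blinfun_apply v w / blinfun_apply \<xi> w) \<xi> v) (at \<xi> within U)" by simp
qed simp

text \<open>The weighted Lagrange identity, i.e. the defect in the Cauchy-Schwarz inequality. In the
  induction step the new pairs are those with larger member \<open>Suc n\<close>; they supply the
  mixed products on the right, while the two squares of \<open>L (Suc n)\<close> cancel.\<close>

lemma weighted_Lagrange_identity:
  fixes a b L :: "nat \<Rightarrow> real"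
  shows "(\<Sum>(r, s)\<in>{(r, s). r < s \<and> s \<le> n}. L r * L s * ((a r - a s) * (b r - b s))) =
    (\<Sum>r\<in>{0..n}. L r) * (\<Sum>r\<in>{0..n}. L r * a r * b r) - (\<Sum>r\<in>{0..n}. L r * a r) * (\<Sum>r\<in>{0..n}. L r * b r)"
proof (induction n)
  case 0
  have "{(r, s). r < s \<and> s \<le> (0::nat)} = {}" by auto
  then show ?case by (simp only:) simp
next
  case (Suc n)
  have fin: "finite {(r, s). r < s \<and> s \<le> n}"
    by (rule finite_subset[of _ "{0..n} \<times> {0..n}"]) auto
  have "{(r, s). r < s \<and> s \<le> Suc n} = {(r, s). r < s \<and> s \<le> n} \<union> (\<lambda>r. (r, Suc n)) ` {0..n}"
    by (auto simp: le_Suc_eq)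
  then have "(\<Sum>(r, s)\<in>{(r, s). r < s \<and> s \<le> Suc n}. L r * L s * ((a r - a s) * (b r - b s))) =
      (\<Sum>(r, s)\<in>{(r, s). r < s \<and> s \<le> n}. L r * L s * ((a r - a s) * (b r - b s))) +
      (\<Sum>r\<in>{0..n}. L r * L (Suc n) * ((a r - a (Suc n)) * (b r - b (Suc n))))"
    using fin by (simp only:, subst sum.union_disjoint) (auto simp: sum.reindex inj_on_def)
  also have "(\<Sum>r\<in>{0..n}. L r * L (Suc n) * ((a r - a (Suc n)) * (b r - b (Suc n)))) =
     L (Suc n) * ((\<Sum>r\<in>{0..n}. L r * a r * b r) - (\<Sum>r\<in>{0..n}. L r * a r) * b (Suc n) -
       a (Suc n) * (\<Sum>r\<in>{0..n}. L r * b r) + (\<Sum>r\<in>{0..n}. L r) * a (Suc n) * b (Suc n))"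
    by (simp add: sum_distrib_left sum_distrib_right flip: sum.distrib sum_subtractf)
       (auto intro!: sum.cong simp: algebra_simps)
  finally show ?case unfolding Suc.IH
    by (simp add: algebra_simps)
qed

section \<open>Products of spheres\<close>

text \<open>The Hermitian product of the i-th factor, conjugate linear in the first argument. Its
  real part is the Euclidean metric, and its imaginary part with first argument z is the contact
  form of the sphere. A function \<open>blk\<close> on the index type replaces the labels (i,r), so
  that sums over r become sums over a fibre.\<close>

definition hblock :: "('s::finite \<Rightarrow> nat) \<Rightarrow> nat \<Rightarrow> complex^'s \<Rightarrow> complex^'s \<Rightarrow> complex" where
  "hblock blk i X Y = (\<Sum>s | blk s = i. cnj (X $ s) * Y $ s)"

lemma bounded_bilinear_hblock: "bounded_bilinear (hblock blk i)"
  unfolding bilinear_conv_bounded_bilinear[symmetric] bilinear_def hblock_def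
  by (auto intro!: linearI
      simp: algebra_simps sum.distrib scaleR_sum_right)

interpretation hblock: bounded_bilinear "hblock blk i" for blk i
  by (rule bounded_bilinear_hblock)

lemma hblock_cnj: "cnj (hblock blk i X Y) = hblock blk i Y X"
  by (simp add: hblock_def mult.commute)

lemma Re_hblock_commute: "Re (hblock blk i X Y) = Re (hblock blk i Y X)"
  and Im_hblock_commute: "Im (hblock blk i X Y) = - Im (hblock blk i Y X)"
  by (simp_all flip: hblock_cnj[of blk i X Y])

lemma Re_hblock_self: "Re (hblock blk i X X) = (\<Sum>s | blk s = i. (cmod (X $ s))\<^sup>2)"
  and Im_hblock_self: "Im (hblock blk i X X) = 0"
  by (simp_all add: hblock_def cmod_power2) (simp add: power2_eq_square)

lemma hblock_smult_right: "hblock blk i X (c *s Y) = c * hblock blk i X Y"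
  by (simp add: hblock_def sum_distrib_left mult_ac)

lemma hblock_Jmap_right: "hblock blk i X (Jmap Y) = \<i> * hblock blk i X Y"
  by (simp add: Jmap_def hblock_smult_right)

lemma gen_field_eq: "gen_field v z = (\<chi> s. \<i> * of_real (v $ s) * z $ s)"
  unfolding gen_field_def torus_act_def
proof (rule vector_derivative_at, rule has_vector_derivative_vec_lambda)
  fix s
  have "((\<lambda>t. cis (t * v $ s) * z $ s) has_vector_derivative (\<i> * of_real (v $ s)) * z $ s) (at 0)"
    using has_vector_derivative_mult_left[OF exp_scaleR_has_vector_derivative_right[of "\<i> * of_real (v $ s)" 0 UNIV], of "z $ s"]
    by (simp add: cis_conv_exp scaleR_conv_of_real mult_ac)
  then show "((\<lambda>t. cis ((t *\<^sub>R v) $ s) * z $ s) has_vector_derivative (\<i> * of_real (v $ s)) * z $ s) (at 0)"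
    by simp
qed

lemma linear_gen_field: "linear (\<lambda>v. gen_field v z)"
proof (rule linearI)
  show "gen_field (c *\<^sub>R v) z = c *\<^sub>R gen_field v z" for c v
    by (simp add: gen_field_eq vec_eq_iff) (simp add: scaleR_conv_of_real)
qed (simp add: gen_field_eq vec_eq_iff algebra_simps)

lemma hblock_gen_field:
  "hblock blk i z (gen_field v z) = \<i> * of_real (\<Sum>s | blk s = i. (cmod (z $ s))\<^sup>2 * v $ s)"
  by (simp add: hblock_def gen_field_eq sum_distrib_left complex_norm_square mult_ac
      del: of_real_power)

definition block_spheres :: "('s::finite \<Rightarrow> nat) \<Rightarrow> nat set \<Rightarrow> (complex^'s) set" where
  "block_spheres blk I = {z. \<forall>i\<in>I. Re (hblock blk i z z) = 2}"

text \<open>One inclusion differentiates the constant squared norms. For the other, z + tX is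
  renormalised in each block: as <z,X> has real part 0, its squared norm is 2(1 + t^2 q), even in t,
  so the normalising factor has derivative 0 at t = 0 and the velocity remains
  \<open>X\<close>.\<close>

lemma tangent_space_block_spheres:
  assumes z: "z \<in> block_spheres blk I"
  shows "tangent_space (block_spheres blk I) z = {X. \<forall>i\<in>I. Re (hblock blk i z X) = 0}"
proof safe
  fix X i assume X: "X \<in> tangent_space (block_spheres blk I) z" and i: "i \<in> I"
  have "((\<lambda>w. hblock blk i w w) has_derivative (\<lambda>V. hblock blk i z V + hblock blk i V z))
      (at z within block_spheres blk I)"
    by (intro hblock.FDERIV has_derivative_ident)
  then have "((\<lambda>w. Re (hblock blk i w w)) has_derivative (\<lambda>V. Re (hblock blk i z V + hblock blk i V z)))
      (at z within block_spheres blk I)"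
    by (rule has_derivative_Re)
  then have "Re (hblock blk i z X + hblock blk i X z) = (\<lambda>_. 0) X"
    by (rule derivative_unique_on_tangent_space[OF X open_UNIV UNIV_I, rotated])
      (use i in \<open>auto simp: block_spheres_def\<close>)
  then show "Re (hblock blk i z X) = 0" by (simp add: Re_hblock_commute[of blk i X z])
next
  fix X assume X: "\<forall>i\<in>I. Re (hblock blk i z X) = 0"
  define q where "q i = Re (hblock blk i X X) / 2" for i
  have q: "q i \<ge> 0" for i unfolding q_def Re_hblock_self by (simp add: sum_nonneg)
  \<comment> \<open>Positivity is needed for every t, since the definition of the tangent space asks
    for curves that stay in the set at all times.\<close>
  have q1: "1 + t\<^sup>2 * q i > 0" for t i using q[of i] by (simp add: add_pos_nonneg)
  define \<gamma> where "\<gamma> t = (\<chi> s. (1 / sqrt (1 + t\<^sup>2 * q (blk s))) *\<^sub>R (z $ s + t *\<^sub>R X $ s))" for t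
  have "\<gamma> t \<in> block_spheres blk I" for t
    unfolding block_spheres_def
  proof safe
    fix i assume i: "i \<in> I"
    have "Re (hblock blk i (\<gamma> t) (\<gamma> t)) = (\<Sum>s | blk s = i. (cmod ((z + t *\<^sub>R X) $ s))\<^sup>2 / (1 + t\<^sup>2 * q i))"
      unfolding Re_hblock_self using q1[of t i]
      by (intro sum.cong) (auto simp: \<gamma>_def power_divide)
    also have "\<dots> = Re (hblock blk i (z + t *\<^sub>R X) (z + t *\<^sub>R X)) / (1 + t\<^sup>2 * q i)"
      by (simp add: Re_hblock_self sum_divide_distrib)
    also have "Re (hblock blk i (z + t *\<^sub>R X) (z + t *\<^sub>R X)) = 2 * (1 + t\<^sup>2 * q i)"
      using z i X Re_hblock_commute[of blk i X z]
      by (simp add: hblock.add_left hblock.add_right hblock.scaleR_left hblock.scaleR_right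
          block_spheres_def q_def power2_eq_square algebra_simps)
    finally show "Re (hblock blk i (\<gamma> t) (\<gamma> t)) = 2"
      using q1[of t i] by (metis less_irrefl nonzero_mult_div_cancel_right)
  qed
  moreover have "\<gamma> 0 = z" by (simp add: \<gamma>_def)
  moreover have "(\<gamma> has_vector_derivative (\<chi> s. X $ s)) (at 0)"
    unfolding \<gamma>_def
  proof (rule has_vector_derivative_vec_lambda)
    fix s
    have "((\<lambda>t. 1 / sqrt (1 + t\<^sup>2 * q (blk s))) has_real_derivative 0) (at 0)"
      by (auto intro!: derivative_eq_intros)
    moreover have "((\<lambda>t. z $ s + t *\<^sub>R X $ s) has_vector_derivative X $ s) (at 0)"
      by (auto intro!: derivative_eq_intros)
    ultimately show "((\<lambda>t. (1 / sqrt (1 + t\<^sup>2 * q (blk s))) *\<^sub>R (z $ s + t *\<^sub>R X $ s))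
        has_vector_derivative X $ s) (at 0)"
      using has_vector_derivative_scaleR by fastforce
  qed
  ultimately show "X \<in> tangent_space (block_spheres blk I) z"
    unfolding tangent_space_def by (auto simp: vec_nth_inverse)
qed

lemma Jmap_Jmap: "Jmap (Jmap X) = - X"
  by (simp add: Jmap_def vec_eq_iff flip: mult.assoc)

text \<open>Applying J exchanges the real and imaginary parts of <z,X> up to sign, so the two
  tangency conditions together express Hermitian orthogonality to each block of z.\<close>

lemma cr_dist_block_spheres:
  assumes z: "z \<in> block_spheres blk I"
  shows "cr_dist (block_spheres blk I) z = {X. \<forall>i\<in>I. hblock blk i z X = 0}"
proof -
  have "X \<in> Jmap ` {X. \<forall>i\<in>I. Re (hblock blk i z X) = 0} \<longleftrightarrow> (\<forall>i\<in>I. Im (hblock blk i z X) = 0)" for X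
  proof
    assume "\<forall>i\<in>I. Im (hblock blk i z X) = 0"
    moreover have "X = Jmap (- Jmap X)"
      using Jmap_Jmap[of X] by (simp add: Jmap_def vec_eq_iff)
    moreover have "hblock blk i z (- Jmap X) = - \<i> * hblock blk i z X" for i
      by (simp add: hblock.minus_right hblock_Jmap_right)
    ultimately show "X \<in> Jmap ` {X. \<forall>i\<in>I. Re (hblock blk i z X) = 0}"
      by (intro image_eqI[of _ _ "- Jmap X"]) auto
  qed (auto simp: hblock_Jmap_right)
  then show ?thesis
    unfolding cr_dist_def tangent_space_block_spheres[OF z] by (auto simp: complex_eq_iff)
qed

section \<open>The exterior derivative of a combination of contact forms\<close>

text \<open>The normal vector of the i-th sphere, extended linearly in \<open>w\<close> to the whole
  space so that it can be differentiated.\<close>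

definition rad :: "('s::finite \<Rightarrow> nat) \<Rightarrow> nat \<Rightarrow> complex^'s \<Rightarrow> complex^'s" where
  "rad blk i w = (\<chi> s. if blk s = i then w $ s else 0)"

lemma linear_rad: "linear (rad blk i)"
  by (auto intro!: linearI simp: rad_def vec_eq_iff)

lemma hblock_rad: "hblock blk j V (rad blk i w) = (if i = j then hblock blk i V w else 0)"
  by (auto simp: hblock_def rad_def intro!: sum.neutral)

text \<open>\<open>V\<close> is the orthogonal projection of \<open>Y\<close> to the tangent space
  at \<open>w\<close>; the divisor 2 is the squared norm of a block. The contact forms do not see
  the correction because <w,w> is real. This is needed since a fixed \<open>Y\<close> tangent at one
  point is not tangent at its neighbours.\<close>

lemma block_spheres_tangential_part:
  fixes w Y :: "complex^'s::finite"
  assumes w: "w \<in> block_spheres blk I" and I: "finite I"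
  defines "V \<equiv> Y - (\<Sum>i\<in>I. (Re (hblock blk i w Y) / 2) *\<^sub>R rad blk i w)"
  shows "V \<in> tangent_space (block_spheres blk I) w"
    and "i \<in> I \<Longrightarrow> Im (hblock blk i w V) = Im (hblock blk i w Y)"
proof -
  have *: "hblock blk i w V = hblock blk i w Y - (Re (hblock blk i w Y) / 2) *\<^sub>R hblock blk i w w" if "i \<in> I" for i
    using that I by (simp add: V_def hblock.diff_right hblock.sum_right hblock.scaleR_right hblock_rad if_distrib
      if_distrib[of "\<lambda>x. _ *\<^sub>R x"] cong: if_cong)
  show "V \<in> tangent_space (block_spheres blk I) w"
    unfolding tangent_space_block_spheres[OF w] using w by (simp add: * block_spheres_def)
  show "Im (hblock blk i w V) = Im (hblock blk i w Y)" if "i \<in> I"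
    using * that by (simp add: Im_hblock_self)
qed

text \<open>The last sum, symmetric in \<open>X\<close> and \<open>Y\<close>, carries the whole dependence on the extension
  \<open>a\<close>, which is why the exterior derivative is well defined.\<close>

lemma derivative_of_extension:
  fixes a :: "complex^'s::finite \<Rightarrow> (complex^'s) \<Rightarrow>\<^sub>L real"
  assumes z: "z \<in> block_spheres blk I" and I: "finite I"
    and X: "X \<in> cr_dist (block_spheres blk I) z" and Y: "Y \<in> cr_dist (block_spheres blk I) z"
    and C: "\<And>i. i \<in> I \<Longrightarrow> (\<lambda>w. C i w) differentiable (at z)"
    and \<alpha>: "\<And>w V. w \<in> block_spheres blk I \<Longrightarrow> V \<in> tangent_space (block_spheres blk I) w \<Longrightarrow>
          \<alpha> w V = (\<Sum>i\<in>I. C i w * Im (hblock blk i w V))"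
    and W: "open W" "z \<in> W"
    and a: "\<And>w V. w \<in> block_spheres blk I \<inter> W \<Longrightarrow> V \<in> tangent_space (block_spheres blk I) w \<Longrightarrow>
          blinfun_apply (a w) V = \<alpha> w V"
    and a': "(a has_derivative a') (at z)"
  shows "blinfun_apply (a' X) Y = (\<Sum>i\<in>I. C i z * Im (hblock blk i X Y)) +
    (\<Sum>i\<in>I. (1/2) * Re (hblock blk i X Y) * blinfun_apply (a z) (rad blk i z))"
proof -
  let ?N = "block_spheres blk I"
  define h where "h w = (\<Sum>i\<in>I. C i w * Im (hblock blk i w Y)) +
      (\<Sum>i\<in>I. (1/2) * Re (hblock blk i w Y) * blinfun_apply (a w) (rad blk i w))" for w
  have eq: "blinfun_apply (a w) Y = h w" if w: "w \<in> ?N \<inter> W" for w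
  proof -
    define V where "V = Y - (\<Sum>i\<in>I. (Re (hblock blk i w Y) / 2) *\<^sub>R rad blk i w)"
    have V: "V \<in> tangent_space ?N w" "\<And>i. i \<in> I \<Longrightarrow> Im (hblock blk i w V) = Im (hblock blk i w Y)"
      using block_spheres_tangential_part[OF _ I, where w=w and blk=blk and Y=Y] w by (auto simp: V_def)
    have "blinfun_apply (a w) Y = blinfun_apply (a w) V +
        (\<Sum>i\<in>I. (1/2) * Re (hblock blk i w Y) * blinfun_apply (a w) (rad blk i w))"
      by (simp add: V_def blinfun.diff_right blinfun.sum_right blinfun.scaleR_right)
    then show ?thesis using V a w \<alpha> by (simp add: h_def)
  qed
  obtain C' where C': "\<And>i. i \<in> I \<Longrightarrow> (C i has_derivative C' i) (at z)"
    using C unfolding differentiable_def by metis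
  define D where "D i H = blinfun_apply (a z) (rad blk i H) + blinfun_apply (a' H) (rad blk i z)" for i H
  have D: "((\<lambda>w. blinfun_apply (a w) (rad blk i w)) has_derivative D i) (at z)" for i
    unfolding D_def by (intro blinfun.FDERIV a' linear_imp_has_derivative linear_rad)
  have hb: "((\<lambda>w. hblock blk i w Y) has_derivative (\<lambda>H. hblock blk i H Y)) (at z)" for i
    by (rule bounded_linear_imp_has_derivative[OF hblock.bounded_linear_left])
  \<comment> \<open>The terms with \<open>C'\<close> or \<open>D i\<close> have a part of this
    number as a factor and drop out: no derivative of \<open>C\<close> or \<open>a\<close> survives
    on the right.\<close>
  have hz: "i \<in> I \<Longrightarrow> hblock blk i z Y = 0" for i
    using Y by (simp add: cr_dist_block_spheres[OF z])
  have "(h has_derivative (\<lambda>H. (\<Sum>i\<in>I. C i z * Im (hblock blk i H Y) + C' i H * Im (hblock blk i z Y)) +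
      (\<Sum>i\<in>I. (1/2) * Re (hblock blk i z Y) * D i H + (1/2) * Re (hblock blk i H Y) * blinfun_apply (a z) (rad blk i z)))) (at z)"
    unfolding h_def
    by (intro has_derivative_add has_derivative_sum has_derivative_mult C' D
        has_derivative_Im has_derivative_Re has_derivative_mult_right hb)
  then have h': "(h has_derivative (\<lambda>H. (\<Sum>i\<in>I. C i z * Im (hblock blk i H Y)) +
      (\<Sum>i\<in>I. (1/2) * Re (hblock blk i H Y) * blinfun_apply (a z) (rad blk i z)))) (at z)"
    by (simp add: hz cong: sum.cong)
  have aY: "((\<lambda>w. blinfun_apply (a w) Y) has_derivative (\<lambda>H. blinfun_apply (a' H) Y)) (at z)"
    using blinfun.FDERIV[OF a' has_derivative_const[of Y]] by (simp add: blinfun.zero_right)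
  have "X \<in> tangent_space ?N z" using X by (simp add: cr_dist_def)
  from derivative_unique_on_tangent_space[OF this W eq has_derivative_at_withinI[OF aY] has_derivative_at_withinI[OF h']]
  show ?thesis .
qed

text \<open>Exchanging \<open>X\<close> and \<open>Y\<close> changes the sign of the imaginary part
  of <X,Y> but not of the real part. Thus the terms depending on the extension cancel and the others
  double, which is the origin of the factor 2.\<close>

lemma ext_deriv_block_spheres:
  assumes z: "z \<in> block_spheres blk I" and I: "finite I"
    and X: "X \<in> cr_dist (block_spheres blk I) z" and Y: "Y \<in> cr_dist (block_spheres blk I) z"
    and C: "\<And>i. i \<in> I \<Longrightarrow> (\<lambda>w. C i w) differentiable (at z)"
    and \<alpha>: "\<And>w V. w \<in> block_spheres blk I \<Longrightarrow> V \<in> tangent_space (block_spheres blk I) w \<Longrightarrow>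
          \<alpha> w V = (\<Sum>i\<in>I. C i w * Im (hblock blk i w V))"
  shows "ext_deriv (block_spheres blk I) \<alpha> z X Y = 2 * (\<Sum>i\<in>I. C i z * Im (hblock blk i X Y))"
  unfolding ext_deriv_def
proof (rule the_equality)
  let ?N = "block_spheres blk I"
  have val: "blinfun_apply (a' X) Y - blinfun_apply (a' Y) X = 2 * (\<Sum>i\<in>I. C i z * Im (hblock blk i X Y))"
    if "open W" "z \<in> W" "\<forall>w\<in>?N \<inter> W. \<forall>V\<in>tangent_space ?N w. blinfun_apply (a w) V = \<alpha> w V"
      "(a has_derivative a') (at z)" for a a' W
    using derivative_of_extension[OF z I X Y C \<alpha>, of W a a'] derivative_of_extension[OF z I Y X C \<alpha>, of W a a'] that
    by (simp add: Re_hblock_commute[of blk _ Y X] Im_hblock_commute[of blk _ Y X] sum_negf)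
  then show "c = 2 * (\<Sum>i\<in>I. C i z * Im (hblock blk i X Y))"
    if "\<exists>a a' W. open W \<and> z \<in> W \<and> (\<forall>w\<in>?N \<inter> W. \<forall>V\<in>tangent_space ?N w. blinfun_apply (a w) V = \<alpha> w V) \<and>
         (a has_derivative a') (at z) \<and> c = blinfun_apply (a' X) Y - blinfun_apply (a' Y) X" for c
  proof -
    from that obtain a a' W where *: "open W" "z \<in> W"
      "\<forall>w\<in>?N \<inter> W. \<forall>V\<in>tangent_space ?N w. blinfun_apply (a w) V = \<alpha> w V"
      "(a has_derivative a') (at z)" "c = blinfun_apply (a' X) Y - blinfun_apply (a' Y) X"
      by (elim exE conjE)
    show ?thesis unfolding *(5) by (rule val[OF *(1-4)])
  qed
  \<comment> \<open>Existence of an extension: the contact forms make sense on all ambient vectors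
    and are linear in the base point, so its differentiability reduces to that of
    \<open>C\<close>.\<close>
  define \<Theta> where "\<Theta> i w = Blinfun (\<lambda>V. Im (hblock blk i w V))" for i w
  have \<Theta>: "blinfun_apply (\<Theta> i w) V = Im (hblock blk i w V)" for i w V
    unfolding \<Theta>_def
    by (simp add: bounded_linear_Blinfun_apply bounded_linear_compose[OF bounded_linear_Im hblock.bounded_linear_right])
  have "linear (\<Theta> i)" for i
    by (auto intro!: linearI blinfun_eqI simp: \<Theta> blinfun.add_left blinfun.scaleR_left hblock.add_left hblock.scaleR_left)
  then have "\<Theta> i differentiable (at z)" for i
    by (simp add: linear_conv_bounded_linear bounded_linear_imp_differentiable)
  then have "(\<lambda>w. \<Sum>i\<in>I. C i w *\<^sub>R \<Theta> i w) differentiable (at z)"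
    by (intro differentiable_sum I ballI differentiable_scaleR C)
  then obtain a' where a': "((\<lambda>w. \<Sum>i\<in>I. C i w *\<^sub>R \<Theta> i w) has_derivative a') (at z)"
    by (auto simp: differentiable_def)
  have ext: "\<forall>w\<in>?N \<inter> UNIV. \<forall>V\<in>tangent_space ?N w. blinfun_apply (\<Sum>i\<in>I. C i w *\<^sub>R \<Theta> i w) V = \<alpha> w V"
    by (simp add: \<alpha> blinfun.sum_left blinfun.scaleR_left \<Theta>)
  show "\<exists>a a' W. open W \<and> z \<in> W \<and> (\<forall>w\<in>?N \<inter> W. \<forall>V\<in>tangent_space ?N w. blinfun_apply (a w) V = \<alpha> w V) \<and>
         (a has_derivative a') (at z) \<and>
         2 * (\<Sum>i\<in>I. C i z * Im (hblock blk i X Y)) = blinfun_apply (a' X) Y - blinfun_apply (a' Y) X"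
    by (intro exI conjI) (rule open_UNIV UNIV_I ext a' val[OF open_UNIV UNIV_I ext a', symmetric])+
qed

section \<open>Levi--Kaehler pairs\<close>

text \<open>The value of the i-th contact form on K_v, equal to 2 sum_r sigma_ir v_ir.
  Transversality is used in the form that, at each point of \<open>N\<close>, these functionals are
  a basis of the dual of \<open>g\<close> (\<open>mu_inj\<close>, \<open>mu_surj\<close>).\<close>

definition mu :: "('s::finite \<Rightarrow> nat) \<Rightarrow> complex^'s \<Rightarrow> nat \<Rightarrow> real^'s \<Rightarrow> real" where
  "mu blk w i v = (\<Sum>s | blk s = i. (cmod (w $ s))\<^sup>2 * v $ s)"

lemma linear_mu: "linear (mu blk w i)"
  by (auto intro!: linearI simp: mu_def algebra_simps sum.distrib sum_distrib_left)

lemma hblock_gen_field_mu: "hblock blk i z (gen_field v z) = \<i> * of_real (mu blk z i v)"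
  by (simp add: hblock_gen_field mu_def)

lemma has_derivative_norm_sq_nth:
  fixes z :: "('a::real_inner)^'s::finite"
  shows "((\<lambda>w. (norm (w $ n))\<^sup>2) has_derivative (\<lambda>H. 2 * (z $ n \<bullet> H $ n))) (at z)"
proof -
  have "((\<lambda>w. w $ n) has_derivative (\<lambda>H. H $ n)) (at z)"
    by (rule bounded_linear.has_derivative[OF bounded_linear_vec_nth has_derivative_ident])
  from has_derivative_inner[OF this this] show ?thesis
    by (simp add: power2_norm_eq_inner inner_commute)
qed

lemma gen_field_tangent:
  "z \<in> block_spheres blk I \<Longrightarrow> gen_field v z \<in> tangent_space (block_spheres blk I) z"
  by (simp add: tangent_space_block_spheres hblock_gen_field_mu)

lemma gen_field_cr_dist_iff:
  "z \<in> block_spheres blk I \<Longrightarrow>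
    gen_field v z \<in> cr_dist (block_spheres blk I) z \<longleftrightarrow> (\<forall>i\<in>I. mu blk z i v = 0)"
  by (simp add: cr_dist_block_spheres hblock_gen_field_mu)

text \<open>The setting with \<open>blk\<close> in place of the labels (i,r). The assumption
  \<open>two_in_block\<close> expresses m_i \<ge> 1: every factor then has nonzero horizontal
  vectors, on which positivity can be tested.\<close>

locale levi_pair =
  fixes blk :: "'s::finite \<Rightarrow> nat" and I :: "nat set"
    and N :: "(complex ^ 's) set"
    and \<epsilon> :: "real \<Rightarrow> 'h::euclidean_space" and d :: "'h \<Rightarrow> 't::euclidean_space"
    and L :: "real ^ 's \<Rightarrow> 'h"
    and g :: "(real ^ 's) set" and lam :: "real ^ 's \<Rightarrow> real"
  assumes range_blk: "range blk = I"
    and two_in_block: "\<And>i. i \<in> I \<Longrightarrow> \<exists>s s'. s \<noteq> s' \<and> blk s = i \<and> blk s' = i"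
    and N_eq: "N = block_spheres blk I"
    and lin_eps: "linear \<epsilon>" and inj_eps: "inj \<epsilon>" and lin_d: "linear d" and surj_d: "surj d"
    and exact: "range \<epsilon> = {x. d x = 0}"
    and dims: "DIM('t) + card I = CARD('s)"
    and lin_L: "linear L" and surj_L: "surj L"
    and g_eq: "g = pair_g d L" and lam_eq: "lam = pair_lam \<epsilon> L"
    and trans: "acts_transversally N g (card I)"
    and pos: "positive_pair N g lam"
begin

lemma finite_I: "finite I"
  unfolding range_blk[symmetric] by simp

lemma blk_in_I [simp]: "blk s \<in> I"
  using range_blk by blast

lemma sum_blocks: "(\<Sum>i\<in>I. \<Sum>s | blk s = i. f s) = (\<Sum>s\<in>UNIV. f s :: 'a::comm_monoid_add)"
  using sum.group[of UNIV I blk f] finite_I range_blk by simp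

lemma g_iff: "v \<in> g \<longleftrightarrow> d (L v) = 0"
  by (simp add: g_eq pair_g_def)

lemma lin_dL: "linear (\<lambda>v. d (L v))"
  using linear_compose[OF lin_L lin_d] by (simp add: o_def)

lemma subspace_g: "subspace g"
  using linear_subspace_kernel[OF lin_dL] by (simp add: g_eq pair_g_def)

lemma dim_g: "dim g = card I"
proof -
  have "surj (\<lambda>v. d (L v))" using comp_surj[OF surj_L surj_d] by (simp add: o_def)
  from dim_kernel_of_surj[OF lin_dL this] dims show ?thesis
    by (simp add: g_eq pair_g_def)
qed

lemma L_on_g: "v \<in> g \<Longrightarrow> L v = \<epsilon> (lam v)"
proof -
  assume "v \<in> g"
  then have "L v \<in> range \<epsilon>" by (simp add: exact g_iff)
  then obtain c where "L v = \<epsilon> c" by blast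
  moreover from this have "lam v = c"
    unfolding lam_eq pair_lam_def using inj_eps by (auto simp: inj_def)
  ultimately show ?thesis by simp
qed

lemma lam_eqI: "v \<in> g \<Longrightarrow> L v = \<epsilon> c \<Longrightarrow> lam v = c"
  using L_on_g inj_eps by (metis injD)

text \<open>A linear functional on all of \<open>real^'s\<close> that agrees with \<open>lam\<close>
  on \<open>g\<close>. Off \<open>g\<close> the vector \<open>L v\<close> is no multiple of
  \<open>\<epsilon> 1\<close>, and \<open>lam\<close> is unspecified; but Cramer's rule produces
  single coordinates, so values on coordinate vectors are required.\<close>

definition lamx :: "real^'s \<Rightarrow> real" where
  "lamx v = (L v \<bullet> \<epsilon> 1) / (\<epsilon> 1 \<bullet> \<epsilon> 1)"

lemma linear_lamx: "linear lamx"
  by (auto intro!: linearI simp: lamx_def linear_add[OF lin_L] linear_scale[OF lin_L] inner_left_distrib add_divide_distrib)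

lemma eps_1: "\<epsilon> 1 \<noteq> 0"
  using inj_eps linear_0[OF lin_eps] by (metis injD zero_neq_one)

lemma eps_scale: "\<epsilon> c = c *\<^sub>R \<epsilon> 1"
  using linear_scale[OF lin_eps, of c 1] by simp

lemma lam_eq_lamx: "v \<in> g \<Longrightarrow> lam v = lamx v"
  unfolding lamx_def using L_on_g[of v] eps_1 eps_scale[of "lam v"] by simp

lemma transD:
  assumes "z \<in> N"
  shows "tangent_space N z = {X + Y | X Y. X \<in> cr_dist N z \<and> Y \<in> (\<lambda>v. gen_field v z) ` g}"
    and "cr_dist N z \<inter> (\<lambda>v. gen_field v z) ` g = {0}"
    and "dim ((\<lambda>v. gen_field v z) ` g) = card I"
proof -
  have "span ((\<lambda>v. gen_field v z) ` g) = (\<lambda>v. gen_field v z) ` g"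
    using linear_span_image[OF linear_gen_field, of z g] subspace_g by (metis span_eq_iff)
  note sp = this
  have *: "tangent_space N z = {X + Y | X Y. X \<in> cr_dist N z \<and> Y \<in> span ((\<lambda>v. gen_field v z) ` g)} \<and>
      cr_dist N z \<inter> span ((\<lambda>v. gen_field v z) ` g) = {0} \<and> dim (span ((\<lambda>v. gen_field v z) ` g)) = card I"
    using trans assms unfolding acts_transversally_def Let_def by (rule bspec)
  show "tangent_space N z = {X + Y | X Y. X \<in> cr_dist N z \<and> Y \<in> (\<lambda>v. gen_field v z) ` g}"
    "cr_dist N z \<inter> (\<lambda>v. gen_field v z) ` g = {0}" "dim ((\<lambda>v. gen_field v z) ` g) = card I"
    using * unfolding sp by simp_all
qed

text \<open>Vanishing moments make K_v horizontal, hence 0 by transversality. Since the K_v with v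
  in \<open>g\<close> span a space of the same dimension as \<open>g\<close>, this forces v =
  0.\<close>

lemma mu_inj:
  assumes "z \<in> N" "v \<in> g" "\<And>i. i \<in> I \<Longrightarrow> mu blk z i v = 0"
  shows "v = 0"
proof -
  have "gen_field v z \<in> cr_dist N z"
    using assms gen_field_cr_dist_iff[of z blk I v] by (simp add: N_eq)
  then have "gen_field v z \<in> {0}"
    unfolding transD(2)[OF assms(1), symmetric] using assms(2) by simp
  then have "gen_field v z = gen_field 0 z" by (simp add: linear_0[OF linear_gen_field])
  moreover have "inj_on (\<lambda>v. gen_field v z) g"
    by (rule inj_on_if_dim_image_eq[OF linear_gen_field subspace_g]) (simp add: transD(3)[OF assms(1)] dim_g)
  ultimately show ?thesis
    using assms(2) subspace_0[OF subspace_g] by (metis inj_onD)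
qed

lemma tangent_decomp:
  assumes "z \<in> N" "X \<in> tangent_space N z"
  shows "\<exists>v\<in>g. X - gen_field v z \<in> cr_dist N z \<and> (\<forall>i\<in>I. mu blk z i v = Im (hblock blk i z X))"
proof -
  obtain v where v: "v \<in> g" "X - gen_field v z \<in> cr_dist N z"
    using assms(2) unfolding transD(1)[OF assms(1)] by auto
  have "mu blk z i v = Im (hblock blk i z X)" if "i \<in> I" for i
    using v(2) assms(1) that unfolding N_eq
    by (auto simp: cr_dist_block_spheres hblock.diff_right hblock_gen_field_mu)
  then show ?thesis using v by blast
qed

text \<open>The vector equal to \<open>y i / 2\<close> on the i-th block has the required moments,
  because the squares in a block add up to 2. Removing the horizontal part of its field leaves the
  moments unchanged and leads to an element of \<open>g\<close>.\<close>

lemma mu_surj: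
  assumes "z \<in> N"
  shows "\<exists>v\<in>g. \<forall>i\<in>I. mu blk z i v = y i"
proof -
  define w :: "real^'s" where "w = (\<chi> s. y (blk s) / 2)"
  have "mu blk z i w = y i" if "i \<in> I" for i
  proof -
    have "mu blk z i w = (\<Sum>s | blk s = i. (cmod (z $ s))\<^sup>2 * (y i / 2))"
      unfolding mu_def w_def by (auto intro!: sum.cong)
    also have "\<dots> = Re (hblock blk i z z) * (y i / 2)"
      unfolding Re_hblock_self by (simp add: sum_distrib_right)
    finally show ?thesis using assms that by (simp add: N_eq block_spheres_def)
  qed
  then show ?thesis
    using tangent_decomp[OF assms, of "gen_field w z"] assms gen_field_tangent[of z blk I w]
    by (auto simp: hblock_gen_field_mu N_eq)
qed

section \<open>The coefficients c_i and the Levi form\<close>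

text \<open>Pointwise existence is only the expansion of \<open>lam\<close> in the basis of moments.
  The content is a choice that is differentiable in all ambient directions at the points of
  \<open>N\<close>.\<close>

lemma ex_coef:
  "\<exists>C. \<forall>w\<in>N. (\<forall>i\<in>I. C i differentiable (at w)) \<and> (\<forall>v\<in>g. lam v = (\<Sum>i\<in>I. C i w * mu blk w i v))"
proof (cases "N = {}")
  case False
  then obtain z0 where z0: "z0 \<in> N" by blast
  \<comment> \<open>The basis of \<open>g\<close> dual to the moments at one base point provides the
    right-hand sides of the linear systems for every \<open>w\<close>.\<close>
  have "\<forall>j. \<exists>b\<in>g. \<forall>i\<in>I. mu blk z0 i b = (if i = j then 1 else 0)"
    by (intro allI mu_surj z0)
  then obtain b where b: "\<And>j. b j \<in> g" "\<And>i j. i \<in> I \<Longrightarrow> mu blk z0 i (b j) = (if i = j then 1 else 0)"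
    by metis
  \<comment> \<open>\<open>A w\<close> is the identity modulo \<open>g\<close> and maps \<open>v \<in> g\<close> to \<open>\<Sum>i\<in>I. mu blk w i v *\<^sub>R b i\<close>, so transversality makes
    it invertible on \<open>N\<close>. Cramer's rule for \<open>A w *v x = b j\<close> gives coefficients differentiable in \<open>w\<close>
    on the ambient space, as the exterior derivative requires.\<close>
  define A :: "complex^'s \<Rightarrow> real^'s^'s" where
    "A w = (\<chi> k n. (if k = n then 1 else 0) + ((cmod (w $ n))\<^sup>2 - (cmod (z0 $ n))\<^sup>2) * b (blk n) $ k)" for w
  define B where "B w j k = (\<chi> i n. if n = k then b j $ i else A w $ i $ n)" for w j k
  define C where "C j w = (\<Sum>k\<in>UNIV. det (B w j k) / det (A w) * lamx (axis k 1))" for j w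
  have A: "A w *v v = v + (\<Sum>i\<in>I. (mu blk w i v - mu blk z0 i v) *\<^sub>R b i)" for w v
  proof -
    have "(A w *v v) $ k = v $ k + (\<Sum>i\<in>I. (mu blk w i v - mu blk z0 i v) * b i $ k)" for k
    proof -
      have "(A w *v v) $ k = (\<Sum>n\<in>UNIV. (if k = n then v $ n else 0) + ((cmod (w $ n))\<^sup>2 - (cmod (z0 $ n))\<^sup>2) * v $ n * b (blk n) $ k)"
        unfolding A_def matrix_vector_mult_def by (auto intro!: sum.cong simp: algebra_simps)
      also have "\<dots> = v $ k + (\<Sum>n\<in>UNIV. ((cmod (w $ n))\<^sup>2 - (cmod (z0 $ n))\<^sup>2) * v $ n * b (blk n) $ k)"
        by (simp add: sum.distrib)
      also have "(\<Sum>n\<in>UNIV. ((cmod (w $ n))\<^sup>2 - (cmod (z0 $ n))\<^sup>2) * v $ n * b (blk n) $ k) =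
          (\<Sum>i\<in>I. (mu blk w i v - mu blk z0 i v) * b i $ k)"
        unfolding sum_blocks[symmetric]
        by (auto intro!: sum.cong simp: mu_def sum_distrib_left algebra_simps simp flip: sum_subtractf)
      finally show ?thesis .
    qed
    then show ?thesis by (simp add: vec_eq_iff)
  qed
  have bsum: "(\<Sum>i\<in>I. c i *\<^sub>R b i) \<in> g" for c
    using b(1) by (intro subspace_sum subspace_scale subspace_g)
  have mub: "mu blk z0 j (\<Sum>i\<in>I. c i *\<^sub>R b i) = c j" if "j \<in> I" for c j
    using that finite_I by (simp add: linear_sum[OF linear_mu] linear_scale[OF linear_mu] b(2)[OF that] if_distrib cong: if_cong)
  have Ag: "A w *v v = (\<Sum>i\<in>I. mu blk w i v *\<^sub>R b i)" if "v \<in> g" for w v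
  proof -
    have "v - (\<Sum>i\<in>I. mu blk z0 i v *\<^sub>R b i) = 0"
      by (rule mu_inj[OF z0]) (auto simp: linear_diff[OF linear_mu] mub intro: subspace_diff subspace_g that bsum)
    then show ?thesis unfolding A by (simp add: scaleR_diff_left sum_subtractf)
  qed
  have det: "det (A w) \<noteq> 0" if w: "w \<in> N" for w
  proof -
    \<comment> \<open>A kernel vector lies in \<open>g\<close>, because \<open>A w\<close> differs
      from the identity by values in \<open>g\<close>. Then \<open>Ag\<close> applies, the moments
      at \<open>z0\<close> show that those of \<open>v\<close> at \<open>w\<close> vanish, and
      transversality at \<open>w\<close> gives 0.\<close>
    have "v = 0" if v: "A w *v v = 0" for v
    proof -
      have "v = - (\<Sum>i\<in>I. (mu blk w i v - mu blk z0 i v) *\<^sub>R b i)"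
        using v A by (simp add: eq_neg_iff_add_eq_0)
      then have vg: "v \<in> g" using bsum subspace_neg[OF subspace_g] by metis
      have "mu blk w j v = 0" if "j \<in> I" for j
        using mub[OF that, of "\<lambda>i. mu blk w i v"] v Ag[OF vg, of w] linear_0[OF linear_mu[of blk z0 j]] by simp
      then show "v = 0" using mu_inj[OF w vg] by blast
    qed
    then have "\<exists>B. B ** A w = mat 1" by (simp add: matrix_left_invertible_ker)
    then show ?thesis by (metis invertible_det_nz invertible_left_inverse)
  qed
  have lamx_expand: "lamx v = (\<Sum>k\<in>UNIV. v $ k * lamx (axis k 1))" for v
  proof -
    have "lamx v = lamx (\<Sum>k\<in>UNIV. v $ k *\<^sub>R axis k 1)"
      using basis_expansion[of v] by (simp add: scalar_mult_eq_scaleR)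
    then show ?thesis by (simp add: linear_sum[OF linear_lamx] linear_scale[OF linear_lamx])
  qed
  have "lam v = (\<Sum>i\<in>I. C i w * mu blk w i v)" if w: "w \<in> N" and v: "v \<in> g" for w v
  proof -
    have "\<forall>j. \<exists>v\<in>g. \<forall>i\<in>I. mu blk w i v = (if i = j then 1 else 0)"
      by (intro allI mu_surj w)
    then obtain x where x: "\<And>j. x j \<in> g" "\<And>i j. i \<in> I \<Longrightarrow> mu blk w i (x j) = (if i = j then 1 else 0)"
      by metis
    \<comment> \<open>\<open>A w\<close> carries the dual basis at \<open>w\<close> to the one at
      \<open>z0\<close>, so Cramer's rule computes the coordinates of \<open>x j\<close>.\<close>
    have Cx: "C j w = lamx (x j)" if "j \<in> I" for j
    proof -
      have "A w *v x j = (\<Sum>i\<in>I. if i = j then b i else 0)"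
        unfolding Ag[OF x(1)] by (auto intro!: sum.cong simp: x(2))
      also have "\<dots> = b j" using that finite_I by simp
      finally show ?thesis
        unfolding cramer[OF det[OF w]] C_def B_def lamx_expand[of "x j"] by simp
    qed
    have "v - (\<Sum>i\<in>I. mu blk w i v *\<^sub>R x i) = 0"
    proof (rule mu_inj[OF w])
      show "v - (\<Sum>i\<in>I. mu blk w i v *\<^sub>R x i) \<in> g"
        using x(1) v by (intro subspace_diff subspace_sum subspace_scale subspace_g)
      show "mu blk w j (v - (\<Sum>i\<in>I. mu blk w i v *\<^sub>R x i)) = 0" if "j \<in> I" for j
        using that finite_I
        by (simp add: linear_diff[OF linear_mu] linear_sum[OF linear_mu] linear_scale[OF linear_mu] x(2)[OF that] if_distrib cong: if_cong)
    qed
    then have "lamx v = lamx (\<Sum>i\<in>I. mu blk w i v *\<^sub>R x i)" by simp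
    then show ?thesis
      using v by (simp add: lam_eq_lamx linear_sum[OF linear_lamx] linear_scale[OF linear_lamx] Cx mult.commute)
  qed
  moreover have "C j differentiable (at w)" if w: "w \<in> N" for w j
  proof -
    have c: "(\<lambda>w. (cmod (w $ n))\<^sup>2) differentiable (at w)" for n and w :: "complex^'s"
      by (rule differentiableI[OF has_derivative_norm_sq_nth])
    have dA: "(\<lambda>w. A w $ k $ n) differentiable (at w)" for k n
      unfolding A_def by (simp add: c)
    have dB: "(\<lambda>w. B w j m $ k $ n) differentiable (at w)" for k n m
      unfolding B_def by (cases "n = m") (simp_all add: dA)
    show ?thesis unfolding C_def
      by (intro differentiable_sum ballI differentiable_mult differentiable_divide differentiable_const
          differentiable_det dA dB det[OF w] finite)
  qed
  ultimately show ?thesis by (intro exI[of _ C]) blast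
qed auto

definition coef :: "nat \<Rightarrow> complex^'s \<Rightarrow> real" where
  "coef = (SOME C. \<forall>w\<in>N. (\<forall>i\<in>I. C i differentiable (at w)) \<and> (\<forall>v\<in>g. lam v = (\<Sum>i\<in>I. C i w * mu blk w i v)))"

lemma coef_differentiable: "w \<in> N \<Longrightarrow> i \<in> I \<Longrightarrow> coef i differentiable (at w)"
  and lam_coef: "w \<in> N \<Longrightarrow> v \<in> g \<Longrightarrow> lam v = (\<Sum>i\<in>I. coef i w * mu blk w i v)"
proof -
  have "\<forall>w\<in>N. (\<forall>i\<in>I. coef i differentiable (at w)) \<and> (\<forall>v\<in>g. lam v = (\<Sum>i\<in>I. coef i w * mu blk w i v))"
    unfolding coef_def by (rule someI_ex[OF ex_coef])
  then show "w \<in> N \<Longrightarrow> i \<in> I \<Longrightarrow> coef i differentiable (at w)"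
    "w \<in> N \<Longrightarrow> v \<in> g \<Longrightarrow> lam v = (\<Sum>i\<in>I. coef i w * mu blk w i v)"
    by simp_all
qed

lemma mu_dual:
  assumes "z \<in> N"
  obtains v where "v \<in> g" "\<And>i. i \<in> I \<Longrightarrow> mu blk z i v = (if i = j then 1 else 0)"
  using mu_surj[OF assms, of "\<lambda>i. if i = j then 1 else 0"] by blast

lemma coef_unique:
  assumes z: "z \<in> N" and k: "\<And>v. v \<in> g \<Longrightarrow> (\<Sum>i\<in>I. k i * mu blk z i v) = (\<Sum>i\<in>I. k' i * mu blk z i v)"
    and j: "j \<in> I"
  shows "k j = k' j"
proof -
  obtain v where v: "v \<in> g" "\<And>i. i \<in> I \<Longrightarrow> mu blk z i v = (if i = j then 1 else 0)"
    using mu_dual[OF z] by blast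
  have "(\<Sum>i\<in>I. h i * mu blk z i v) = h j" for h
  proof -
    have "(\<Sum>i\<in>I. h i * mu blk z i v) = (\<Sum>i\<in>I. if i = j then h i else 0)"
      by (intro sum.cong) (auto simp: v(2))
    then show ?thesis using finite_I j by simp
  qed
  with k[OF v(1)] show ?thesis by simp
qed

text \<open>That X - K_v is horizontal means that the moments of v are the contact forms of X, a
  system with exactly one solution in \<open>g\<close>.\<close>

lemma eta_lam_eq:
  assumes z: "z \<in> N" and X: "X \<in> tangent_space N z"
  shows "eta_lam N g lam z X = (\<Sum>i\<in>I. coef i z * Im (hblock blk i z X))"
proof -
  obtain v where v: "v \<in> g" "X - gen_field v z \<in> cr_dist N z"
    "\<And>i. i \<in> I \<Longrightarrow> mu blk z i v = Im (hblock blk i z X)"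
    using tangent_decomp[OF z X] by blast
  have "eta N g z X = v"
    unfolding eta_def
  proof (rule the_equality)
    fix v' assume v': "v' \<in> g \<and> X - gen_field v' z \<in> cr_dist N z"
    have "v' - v = 0"
    proof (rule mu_inj[OF z])
      fix i assume "i \<in> I"
      then have "Im (hblock blk i z (X - gen_field v' z)) = 0"
        using v' z unfolding N_eq by (simp add: cr_dist_block_spheres)
      then show "mu blk z i (v' - v) = 0"
        using v(3)[OF \<open>i \<in> I\<close>] by (simp add: hblock.diff_right hblock_gen_field_mu linear_diff[OF linear_mu])
    qed (use v' v in \<open>simp add: subspace_diff subspace_g\<close>)
    then show "v' = v" by simp
  qed (use v in auto)
  then show ?thesis by (simp add: eta_lam_def lam_coef[OF z v(1)] v(3))
qed

lemma Jmap_cr_dist: "z \<in> N \<Longrightarrow> X \<in> cr_dist N z \<Longrightarrow> Jmap X \<in> cr_dist N z"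
  by (simp add: N_eq cr_dist_block_spheres hblock_Jmap_right)

lemma levi_kaehler_eq:
  assumes z: "z \<in> N" and X: "X \<in> cr_dist N z" and Y: "Y \<in> cr_dist N z"
  shows "levi_kaehler N g lam z X Y = 2 * (\<Sum>i\<in>I. coef i z * Re (hblock blk i X Y))"
proof -
  have "ext_deriv N (eta_lam N g lam) z X (Jmap Y) = 2 * (\<Sum>i\<in>I. coef i z * Im (hblock blk i X (Jmap Y)))"
    using z X Jmap_cr_dist[OF z Y] unfolding N_eq
    by (intro ext_deriv_block_spheres finite_I coef_differentiable[unfolded N_eq] eta_lam_eq[unfolded N_eq])
  then show ?thesis by (simp add: levi_kaehler_def hblock_Jmap_right)
qed

text \<open>Positivity is tested on a horizontal vector supported in block i, where only the i-th
  term of the Levi form survives. Two coordinates suffice for such a vector, as being horizontal is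
  then one complex equation in two unknowns.\<close>

lemma coef_pos:
  assumes z: "z \<in> N" and i: "i \<in> I"
  shows "coef i z > 0"
proof -
  obtain s s' where s: "s \<noteq> s'" "blk s = i" "blk s' = i"
    using two_in_block[OF i] by blast
  obtain a b where ab: "cnj (z $ s) * a + cnj (z $ s') * b = 0" "(a, b) \<noteq> (0, 0)"
  proof (cases "z $ s = 0 \<and> z $ s' = 0")
    case True
    then show ?thesis using that[of 1 0] by simp
  next
    case False
    then show ?thesis using that[of "cnj (z $ s')" "- cnj (z $ s)"] by (auto simp: mult.commute)
  qed
  define X where "X = (\<chi> t. if t = s then a else if t = s' then b else 0)"
  have h: "hblock blk j Z X = (if j = i then cnj (Z $ s) * a + cnj (Z $ s') * b else 0)" for j Z
  proof (cases "j = i")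
    case True
    have "hblock blk i Z X = (\<Sum>t\<in>{s, s'}. cnj (Z $ t) * X $ t)"
      unfolding hblock_def by (rule sum.mono_neutral_right) (use s in \<open>auto simp: X_def\<close>)
    then show ?thesis using True s by (simp add: X_def)
  next
    case False
    then show ?thesis unfolding hblock_def X_def using s by (auto intro!: sum.neutral)
  qed
  have X: "X \<in> cr_dist N z"
    using z h[of _ z] ab(1) by (simp add: N_eq cr_dist_block_spheres)
  have "X \<noteq> 0" using ab(2) s(1) by (auto simp: X_def vec_eq_iff)
  then have "0 < levi_kaehler N g lam z X X"
    using pos z X by (simp add: positive_pair_def)
  also have "\<dots> = 2 * (\<Sum>j\<in>I. if j = i then coef i z * Re (hblock blk i X X) else 0)"
    unfolding levi_kaehler_eq[OF z X X] using h[of _ X] by (auto intro!: sum.cong)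
  also have "\<dots> = 2 * (coef i z * Re (hblock blk i X X))"
    using finite_I i by simp
  finally have "0 < coef i z * Re (hblock blk i X X)" by (simp add: mult.commute)
  moreover have "Re (hblock blk i X X) \<ge> 0" by (simp add: Re_hblock_self sum_nonneg)
  ultimately show ?thesis by (simp add: zero_less_mult_iff)
qed

section \<open>The momentum map and its image\<close>

definition L_axis :: "'s \<Rightarrow> 'h" where "L_axis s = L (axis s 1)"

lemma blinfun_L: "blinfun_apply \<xi> (L v) = (\<Sum>s\<in>UNIV. blinfun_apply \<xi> (L_axis s) * v $ s)"
proof -
  have "L v = L (\<Sum>s\<in>UNIV. v $ s *\<^sub>R axis s 1)"
    using basis_expansion[of v] by (simp add: scalar_mult_eq_scaleR)
  then show ?thesis
    by (simp add: L_axis_def linear_sum[OF lin_L] linear_scale[OF lin_L] blinfun.sum_right blinfun.scaleR_right mult.commute)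
qed

lemma blinfun_eq_if_L_axis:
  fixes \<xi> \<zeta> :: "'h \<Rightarrow>\<^sub>L real"
  shows "(\<And>s. blinfun_apply \<xi> (L_axis s) = blinfun_apply \<zeta> (L_axis s)) \<Longrightarrow> \<xi> = \<zeta>"
proof (rule blinfun_eqI)
  fix h assume "\<And>s. blinfun_apply \<xi> (L_axis s) = blinfun_apply \<zeta> (L_axis s)"
  moreover obtain v where "h = L v" using surj_L by (metis surjD)
  ultimately show "blinfun_apply \<xi> h = blinfun_apply \<zeta> h" by (simp add: blinfun_L)
qed

definition weight :: "'s \<Rightarrow> complex^'s \<Rightarrow> real" where
  "weight s z = coef (blk s) z * (cmod (z $ s))\<^sup>2"

lemma sum_weight: "(\<Sum>s\<in>UNIV. weight s z * k (blk s) * v $ s) = (\<Sum>i\<in>I. coef i z * k i * mu blk z i v)"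
  unfolding sum_blocks[symmetric] mu_def by (auto intro!: sum.cong simp: sum_distrib_left weight_def mult_ac)

lemma lam_weight: "z \<in> N \<Longrightarrow> v \<in> g \<Longrightarrow> lam v = (\<Sum>s\<in>UNIV. weight s z * v $ s)"
  using lam_coef[of z v] sum_weight[of z "\<lambda>_. 1" v] by simp

text \<open>The coordinate forms of a linear right inverse of \<open>L\<close>. They express the
  momentum map by fixed covectors with scalar coefficients \<open>weight s\<close>, which reduces
  its differentiability to that of \<open>coef\<close>.\<close>

definition \<beta> :: "'s \<Rightarrow> 'h \<Rightarrow>\<^sub>L real" where
  "\<beta> = (SOME \<beta>. \<forall>h. L (\<chi> s. blinfun_apply (\<beta> s) h) = h)"

lemma L_\<beta>: "L (\<chi> s. blinfun_apply (\<beta> s) h) = h"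
proof -
  obtain k where k: "linear k" "L \<circ> k = id"
    using linear_surjective_right_inverse[OF lin_L surj_L] by blast
  have "linear (\<lambda>h. k h $ s)" for s
    using k(1) by (auto intro!: linearI simp: linear_add linear_scale)
  then have "blinfun_apply (Blinfun (\<lambda>h. k h $ s)) h = k h $ s" for s h
    by (simp add: bounded_linear_Blinfun_apply linear_conv_bounded_linear)
  then have "\<forall>h. L (\<chi> s. blinfun_apply (Blinfun (\<lambda>h. k h $ s)) h) = h"
    using k(2) by (simp add: fun_eq_iff)
  then have "\<exists>\<beta>. \<forall>h. L (\<chi> s. blinfun_apply (\<beta> s) h) = h"
    by (intro exI[of _ "\<lambda>s. Blinfun (\<lambda>h. k h $ s)"])
  from someI_ex[OF this] show ?thesis by (simp add: \<beta>_def)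
qed

abbreviation mom :: "complex^'s \<Rightarrow> 'h \<Rightarrow>\<^sub>L real" where "mom \<equiv> hmomentum N g lam L"

text \<open>The right inverse returns \<open>v\<close> only up to the kernel of \<open>L\<close>.
  This kernel lies in \<open>g\<close> and \<open>lam\<close> vanishes on it, so its pairing with
  the weights is 0 and the proposed covector has the required values.\<close>

lemma
  assumes z: "z \<in> N"
  shows mom_eq: "mom z = (\<Sum>s\<in>UNIV. weight s z *\<^sub>R \<beta> s)" and mom_L: "blinfun_apply (mom z) (L v) = (\<Sum>s\<in>UNIV. weight s z * v $ s)"
proof -
  have eta: "eta_lam N g lam z (gen_field v z) = (\<Sum>s\<in>UNIV. weight s z * v $ s)" for v
    using eta_lam_eq[OF z, of "gen_field v z"] gen_field_tangent[of z blk I v] z sum_weight[of z "\<lambda>_. 1" v]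
    by (simp add: hblock_gen_field_mu N_eq)
  have *: "blinfun_apply (\<Sum>s\<in>UNIV. weight s z *\<^sub>R \<beta> s) (L v) = (\<Sum>s\<in>UNIV. weight s z * v $ s)" for v
  proof -
    define v' where "v' = (\<chi> s. blinfun_apply (\<beta> s) (L v))"
    have "L (v' - v) = \<epsilon> 0" using L_\<beta>[of "L v"] by (simp add: v'_def linear_diff[OF lin_L] linear_0[OF lin_eps])
    then have "v' - v \<in> g" "lam (v' - v) = 0"
      using lam_eqI[of "v' - v" 0] by (auto simp: g_iff linear_0[OF lin_d] linear_0[OF lin_eps])
    then have "(\<Sum>s\<in>UNIV. weight s z * (v' - v) $ s) = 0" using lam_weight[OF z] by metis
    then show ?thesis
      by (simp add: v'_def blinfun.sum_left blinfun.scaleR_left algebra_simps sum_subtractf)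
  qed
  show 1: "mom z = (\<Sum>s\<in>UNIV. weight s z *\<^sub>R \<beta> s)"
    unfolding hmomentum_def eta
  proof (rule the_equality)
    fix \<xi> assume "\<forall>v. blinfun_apply \<xi> (L v) = (\<Sum>s\<in>UNIV. weight s z * v $ s)"
    then show "\<xi> = (\<Sum>s\<in>UNIV. weight s z *\<^sub>R \<beta> s)"
      using * by (intro blinfun_eq_if_L_axis) (simp add: L_axis_def)
  qed (use * in simp)
  show "blinfun_apply (mom z) (L v) = (\<Sum>s\<in>UNIV. weight s z * v $ s)" unfolding 1 by (rule *)
qed

lemma mom_L_axis: "z \<in> N \<Longrightarrow> blinfun_apply (mom z) (L_axis s) = weight s z"
  by (simp add: L_axis_def mom_L axis_def if_distrib cong: if_cong)

lemma eps_in_g: obtains v where "v \<in> g" "L v = \<epsilon> 1" "lam v = 1"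
proof -
  obtain v where v: "L v = \<epsilon> 1" using surj_L by (metis surjD)
  have "\<epsilon> 1 \<in> {x. d x = 0}" unfolding exact[symmetric] by (rule rangeI)
  then have "v \<in> g" by (simp add: g_iff v)
  then show ?thesis using that[of v] v lam_eqI[of v 1] by simp
qed

lemma mom_eps: "z \<in> N \<Longrightarrow> blinfun_apply (mom z) (\<epsilon> 1) = 1"
proof -
  assume z: "z \<in> N"
  obtain v where v: "v \<in> g" "L v = \<epsilon> 1" "lam v = 1" using eps_in_g by blast
  show ?thesis using mom_L[OF z, of v] lam_weight[OF z v(1)] v(2,3) by simp
qed

lemma mom_image: "hmomentum_image N g lam L = {\<xi> \<in> affine_A \<epsilon>. \<forall>s. blinfun_apply \<xi> (L_axis s) > 0}"
proof (intro set_eqI iffI)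
  fix \<xi> assume "\<xi> \<in> hmomentum_image N g lam L"
  then show "\<xi> \<in> {\<xi> \<in> affine_A \<epsilon>. \<forall>s. blinfun_apply \<xi> (L_axis s) > 0}"
    by (auto simp: hmomentum_image_def generic_part_def affine_A_def mom_eps mom_L_axis weight_def coef_pos)
next
  fix \<xi> assume xi: "\<xi> \<in> {\<xi> \<in> affine_A \<epsilon>. \<forall>s. blinfun_apply \<xi> (L_axis s) > 0}"
  define a where "a s = blinfun_apply \<xi> (L_axis s)" for s
  have a: "a s > 0" for s using xi by (simp add: a_def)
  define t where "t i = (\<Sum>s | blk s = i. a s)" for i
  have t: "t i > 0" if "i \<in> I" for i
    unfolding t_def using that range_blk by (intro sum_pos a) auto
  \<comment> \<open>In each block the squared moduli must be proportional to the prescribed values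
    \<open>a s\<close>; their sum 2 fixes the factor.\<close>
  define z :: "complex^'s" where "z = (\<chi> s. of_real (sqrt (2 * a s / t (blk s))))"
  have zs: "(cmod (z $ s))\<^sup>2 = 2 * a s / t (blk s)" for s
    using a[of s] t[of "blk s"] by (simp add: z_def)
  have zN: "z \<in> N"
  proof -
    have "(\<Sum>s | blk s = i. 2 * a s / t (blk s)) = 2" if "i \<in> I" for i
    proof -
      have "(\<Sum>s | blk s = i. 2 * a s / t (blk s)) = (\<Sum>s | blk s = i. 2 * a s / t i)" by (intro sum.cong) auto
      also have "\<dots> = 2 * t i / t i" by (simp add: t_def sum_distrib_left sum_divide_distrib)
      finally show ?thesis using t[OF that] by simp
    qed
    then show ?thesis by (simp add: N_eq block_spheres_def Re_hblock_self zs)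
  qed
  have "z $ s \<noteq> 0" for s using zs[of s] a[of s] t[of "blk s"] by auto
  then have gen: "z \<in> generic_part N" using zN by (simp add: generic_part_def)
  \<comment> \<open>As \<xi> takes the value 1 on \<open>\<epsilon> 1\<close>, the numbers
    \<open>t i / 2\<close> expand \<open>lam\<close> in the moments at \<open>z\<close>, and the
    expansion is unique.\<close>
  have c: "coef i z = t i / 2" if "i \<in> I" for i
  proof (rule coef_unique[OF zN _ that])
    fix v assume v: "v \<in> g"
    have "(\<Sum>i\<in>I. t i / 2 * mu blk z i v) = (\<Sum>i\<in>I. \<Sum>s | blk s = i. a s * v $ s)"
      unfolding mu_def sum_distrib_left
    proof (intro sum.cong refl)
      fix i s assume "i \<in> I" "s \<in> {s. blk s = i}"
      then show "t i / 2 * ((cmod (z $ s))\<^sup>2 * v $ s) = a s * v $ s" using t[of i] by (auto simp: zs)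
    qed
    also have "\<dots> = blinfun_apply \<xi> (L v)" by (simp add: sum_blocks blinfun_L a_def)
    also have "\<dots> = lam v"
      using xi unfolding L_on_g[OF v] eps_scale[of "lam v"] by (simp add: blinfun.scaleR_right affine_A_def)
    finally show "(\<Sum>i\<in>I. coef i z * mu blk z i v) = (\<Sum>i\<in>I. t i / 2 * mu blk z i v)"
      using lam_coef[OF zN v] by simp
  qed
  have "weight s z = a s" for s
    using t[of "blk s"] by (simp add: weight_def zs c)
  then have "mom z = \<xi>" by (intro blinfun_eq_if_L_axis) (simp add: mom_L_axis[OF zN] a_def)
  with gen show "\<xi> \<in> hmomentum_image N g lam L" by (auto simp: hmomentum_image_def)
qed

text \<open>On \<open>L v\<close> with v in \<open>g\<close> the covector is 0, and it is also the
  combination of moments with coefficients \<open>coef i z * k i\<close>. Independence of the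
  moments on \<open>g\<close> makes these coefficients vanish. Thus no nonzero tangent direction of
  the affine space just rescales whole blocks.\<close>

lemma trans_A_eq_0:
  assumes z: "z \<in> N" and u: "u \<in> trans_A \<epsilon>" and k: "\<And>s. blinfun_apply u (L_axis s) = weight s z * k (blk s)"
  shows "u = 0"
proof -
  have c: "coef i z * k i = 0" if "i \<in> I" for i
  proof (rule coef_unique[OF z _ that, where k="\<lambda>i. coef i z * k i" and k'="\<lambda>_. 0"])
    fix v assume v: "v \<in> g"
    have "(\<Sum>i\<in>I. coef i z * k i * mu blk z i v) = blinfun_apply u (L v)"
      using sum_weight[of z k v] by (simp add: blinfun_L k)
    also have "\<dots> = 0"
      using u unfolding L_on_g[OF v] eps_scale[of "lam v"] by (simp add: blinfun.scaleR_right trans_A_def)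
    finally show "(\<Sum>i\<in>I. coef i z * k i * mu blk z i v) = (\<Sum>i\<in>I. 0 * mu blk z i v)" by simp
  qed
  have "blinfun_apply u (L_axis s) = 0" for s
    using c[of "blk s"] by (auto simp: k weight_def)
  then show ?thesis by (intro blinfun_eq_if_L_axis) simp
qed

section \<open>The differential of the momentum map on J(K cap D)\<close>

definition radial_field :: "complex^'s \<Rightarrow> real^'s \<Rightarrow> complex^'s" where
  "radial_field z x = (\<chi> s. of_real (x $ s) * z $ s)"

lemma radial_field_cr_dist: "z \<in> N \<Longrightarrow> (\<And>i. i \<in> I \<Longrightarrow> mu blk z i x = 0) \<Longrightarrow> radial_field z x \<in> cr_dist N z"
proof -
  have "hblock blk i z (radial_field z x) = of_real (mu blk z i x)" for i
    by (simp add: hblock_def radial_field_def mu_def complex_norm_square mult_ac del: of_real_power)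
  then show "z \<in> N \<Longrightarrow> (\<And>i. i \<in> I \<Longrightarrow> mu blk z i x = 0) \<Longrightarrow> radial_field z x \<in> cr_dist N z"
    by (simp add: N_eq cr_dist_block_spheres)
qed

text \<open>J K_v is the radial field of -v, and the sign disappears because the vanishing of the
  moments is a linear condition.\<close>

lemma J_orbit_dist_eq:
  assumes z: "z \<in> N"
  shows "J_orbit_dist N z = radial_field z ` {x. \<forall>i\<in>I. mu blk z i x = 0}"
proof -
  have sp: "span (range (\<lambda>v. gen_field v z)) = range (\<lambda>v. gen_field v z)"
    using linear_span_image[OF linear_gen_field, of z UNIV] by simp
  have J: "Jmap (gen_field v z) = radial_field z (- v)" for v
    by (simp add: Jmap_def gen_field_eq radial_field_def vec_eq_iff flip: mult.assoc)
  have "range (\<lambda>v. gen_field v z) \<inter> cr_dist N z = (\<lambda>v. gen_field v z) ` {x. \<forall>i\<in>I. mu blk z i x = 0}"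
    using z by (auto simp: N_eq gen_field_cr_dist_iff)
  then have "J_orbit_dist N z = (\<lambda>v. radial_field z (- v)) ` {x. \<forall>i\<in>I. mu blk z i x = 0}"
    unfolding J_orbit_dist_def sp by (simp add: image_image J)
  also have "\<dots> = radial_field z ` uminus ` {x. \<forall>i\<in>I. mu blk z i x = 0}" by (simp add: image_image)
  also have "uminus ` {x. \<forall>i\<in>I. mu blk z i x = 0} = {x. \<forall>i\<in>I. mu blk z i x = 0}"
  proof -
    have "x \<in> uminus ` {x. \<forall>i\<in>I. mu blk z i x = 0}" if "\<forall>i\<in>I. mu blk z i x = 0" for x
      using that by (intro image_eqI[of _ _ "- x"]) (auto simp: linear_neg[OF linear_mu])
    then show ?thesis by (auto simp: linear_neg[OF linear_mu])
  qed
  finally show ?thesis .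
qed

text \<open>The quantity \<open>p\<close> stays existential: all later steps use only that it
  depends on the block alone.\<close>

lemma diff_on_mom:
  assumes z: "z \<in> N" and x: "\<And>i. i \<in> I \<Longrightarrow> mu blk z i x = 0"
  shows "diff_on N mom z (radial_field z x) \<in> trans_A \<epsilon>"
    and "\<exists>p. \<forall>s. blinfun_apply (diff_on N mom z (radial_field z x)) (L_axis s) = weight s z * (p (blk s) + 2 * x $ s)"
proof -
  let ?X = "radial_field z x"
  have X: "?X \<in> tangent_space N z" using radial_field_cr_dist[OF z x] by (simp add: cr_dist_def)
  obtain c' where c': "\<And>i. i \<in> I \<Longrightarrow> (coef i has_derivative c' i) (at z)"
    using coef_differentiable[OF z] unfolding differentiable_def by metis
  define w' where "w' s H = coef (blk s) z * (2 * (z $ s \<bullet> H $ s)) + c' (blk s) H * (cmod (z $ s))\<^sup>2" for s H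
  have w': "(weight s has_derivative w' s) (at z)" for s
    unfolding weight_def w'_def by (intro has_derivative_mult c' has_derivative_norm_sq_nth blk_in_I)
  have "((\<lambda>z. \<Sum>s\<in>UNIV. weight s z *\<^sub>R \<beta> s) has_derivative (\<lambda>H. \<Sum>s\<in>UNIV. w' s H *\<^sub>R \<beta> s)) (at z within N)"
    by (intro has_derivative_sum has_derivative_scaleR_left has_derivative_at_withinI[OF w'])
  from has_derivative_transform[OF z mom_eq this]
  obtain F where F: "(mom has_derivative F) (at z within N)" by blast
  have dF: "diff_on N mom z ?X = F ?X" by (rule diff_on_eq[OF X F])
  have Fh: "((\<lambda>w. blinfun_apply (mom w) h) has_derivative (\<lambda>H. blinfun_apply (F H) h)) (at z within N)" for h
    using blinfun.FDERIV[OF F has_derivative_const[of h]] by (simp add: blinfun.zero_right)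
  have "blinfun_apply (F ?X) (\<epsilon> 1) = 0"
    by (rule derivative_unique_on_tangent_space[OF X open_UNIV UNIV_I _ Fh has_derivative_const[of 1]])
      (simp add: mom_eps)
  then show "diff_on N mom z ?X \<in> trans_A \<epsilon>" by (simp add: dF trans_A_def)
  have "blinfun_apply (F ?X) (L_axis s) = w' s ?X" for s
    by (rule derivative_unique_on_tangent_space[OF X open_UNIV UNIV_I _ Fh has_derivative_at_withinI[OF w']])
      (simp add: mom_L_axis)
  moreover have "w' s ?X = weight s z * (c' (blk s) ?X / coef (blk s) z + 2 * x $ s)" for s
  proof -
    have "z $ s \<bullet> ?X $ s = x $ s * (cmod (z $ s))\<^sup>2"
      unfolding cmod_power2 by (simp add: radial_field_def inner_complex_def power2_eq_square algebra_simps)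
    then show ?thesis using coef_pos[OF z, of "blk s"] by (simp add: w'_def weight_def field_simps)
  qed
  ultimately show "\<exists>p. \<forall>s. blinfun_apply (diff_on N mom z ?X) (L_axis s) = weight s z * (p (blk s) + 2 * x $ s)"
    unfolding dF by (intro exI[of _ "\<lambda>i. c' i ?X / coef i z"]) simp
qed

section \<open>The reduced form on the image\<close>

definition block_vec :: "nat \<Rightarrow> 'h" where "block_vec i = (\<Sum>s | blk s = i. L_axis s)"

text \<open>This is \<open>h_red\<close> on the index type: L_i,infinity is minus
  \<open>block_vec i\<close>, and its sign has been moved out of the quotient.\<close>

definition red_form :: "('h \<Rightarrow>\<^sub>L real) \<Rightarrow> ('h \<Rightarrow>\<^sub>L real) \<Rightarrow> ('h \<Rightarrow>\<^sub>L real) \<Rightarrow> real" where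
  "red_form \<xi> u v = (1/2) * (\<Sum>i\<in>I. (\<Sum>s | blk s = i. blinfun_apply u (L_axis s) * blinfun_apply v (L_axis s) / blinfun_apply \<xi> (L_axis s))
     - blinfun_apply u (block_vec i) * blinfun_apply v (block_vec i) / blinfun_apply \<xi> (block_vec i))"

lemma mom_block_vec:
  assumes z: "z \<in> N" and i: "i \<in> I"
  shows "blinfun_apply (mom z) (block_vec i) = 2 * coef i z"
proof -
  have "blinfun_apply (mom z) (block_vec i) = (\<Sum>s | blk s = i. coef i z * (cmod (z $ s))\<^sup>2)"
    unfolding block_vec_def blinfun.sum_right mom_L_axis[OF z] weight_def by (intro sum.cong) auto
  also have "\<dots> = coef i z * Re (hblock blk i z z)" by (simp add: Re_hblock_self sum_distrib_left)
  finally show ?thesis using z i by (simp add: N_eq block_spheres_def)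
qed

lemma generic_in_N: "z \<in> generic_part N \<Longrightarrow> z \<in> N"
  by (simp add: generic_part_def)

lemma weight_pos: "z \<in> generic_part N \<Longrightarrow> weight s z > 0"
  by (simp add: generic_part_def weight_def coef_pos)

lemma red_form_mom:
  assumes z: "z \<in> generic_part N"
    and x: "\<And>i. i \<in> I \<Longrightarrow> mu blk z i x = 0" and y: "\<And>i. i \<in> I \<Longrightarrow> mu blk z i y = 0"
  shows "red_form (mom z) (diff_on N mom z (radial_field z x)) (diff_on N mom z (radial_field z y)) = levi_kaehler N g lam z (radial_field z x) (radial_field z y)"
proof -
  have zN: "z \<in> N" by (rule generic_in_N[OF z])
  obtain p where p: "\<And>s. blinfun_apply (diff_on N mom z (radial_field z x)) (L_axis s) = weight s z * (p (blk s) + 2 * x $ s)"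
    using diff_on_mom(2)[OF zN x] by blast
  obtain q where q: "\<And>s. blinfun_apply (diff_on N mom z (radial_field z y)) (L_axis s) = weight s z * (q (blk s) + 2 * y $ s)"
    using diff_on_mom(2)[OF zN y] by blast
  let ?u = "diff_on N mom z (radial_field z x)" and ?v = "diff_on N mom z (radial_field z y)"
  have "(\<Sum>s | blk s = i. blinfun_apply ?u (L_axis s) * blinfun_apply ?v (L_axis s) / blinfun_apply (mom z) (L_axis s))
     - blinfun_apply ?u (block_vec i) * blinfun_apply ?v (block_vec i) / blinfun_apply (mom z) (block_vec i)
     = 4 * (coef i z * Re (hblock blk i (radial_field z x) (radial_field z y)))" if i: "i \<in> I" for i
  proof -
    let ?c = "coef i z"
    have c: "?c > 0" by (rule coef_pos[OF zN i])
    have T: "(\<Sum>s | blk s = i. weight s z) = 2 * ?c"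
      using mom_block_vec[OF zN i] by (simp add: block_vec_def blinfun.sum_right mom_L_axis[OF zN])
    have wx: "(\<Sum>s | blk s = i. weight s z * v $ s) = ?c * mu blk z i v" for v
      unfolding mu_def sum_distrib_left weight_def by (auto intro!: sum.cong)
    have block_vec: "(\<Sum>s | blk s = i. weight s z * (r (blk s) + 2 * v $ s)) = 2 * ?c * r i" if "mu blk z i v = 0" for r v
    proof -
      have "(\<Sum>s | blk s = i. weight s z * (r (blk s) + 2 * v $ s)) = (\<Sum>s | blk s = i. weight s z * r i + 2 * (weight s z * v $ s))"
        by (intro sum.cong) (auto simp: algebra_simps)
      also have "\<dots> = (\<Sum>s | blk s = i. weight s z) * r i + 2 * (\<Sum>s | blk s = i. weight s z * v $ s)"
        by (simp add: sum.distrib sum_distrib_left sum_distrib_right)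
      finally show ?thesis by (simp add: T wx that)
    qed
    have "(\<Sum>s | blk s = i. blinfun_apply ?u (L_axis s) * blinfun_apply ?v (L_axis s) / blinfun_apply (mom z) (L_axis s))
       = (\<Sum>s | blk s = i. weight s z * (p i * q i) + 2 * q i * (weight s z * x $ s) + 2 * p i * (weight s z * y $ s) + 4 * (weight s z * x $ s * y $ s))"
      using weight_pos[OF z] by (intro sum.cong) (auto simp: p q mom_L_axis[OF zN] less_imp_neq[symmetric] field_simps)
    also have "\<dots> = (\<Sum>s | blk s = i. weight s z) * (p i * q i) + 2 * q i * (\<Sum>s | blk s = i. weight s z * x $ s)
        + 2 * p i * (\<Sum>s | blk s = i. weight s z * y $ s) + 4 * (\<Sum>s | blk s = i. weight s z * x $ s * y $ s)"
      by (simp add: sum.distrib sum_distrib_left sum_distrib_right)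
    also have "\<dots> = 2 * ?c * (p i * q i) + 4 * (\<Sum>s | blk s = i. weight s z * x $ s * y $ s)"
      by (simp add: T wx x[OF i] y[OF i])
    also have "(\<Sum>s | blk s = i. weight s z * x $ s * y $ s) = ?c * Re (hblock blk i (radial_field z x) (radial_field z y))"
      unfolding hblock_def Re_sum sum_distrib_left radial_field_def weight_def cmod_power2
      by (intro sum.cong) (auto simp: power2_eq_square algebra_simps)
    finally have S: "(\<Sum>s | blk s = i. blinfun_apply ?u (L_axis s) * blinfun_apply ?v (L_axis s) / blinfun_apply (mom z) (L_axis s)) =
        2 * ?c * (p i * q i) + 4 * (?c * Re (hblock blk i (radial_field z x) (radial_field z y)))" .
    \<comment> \<open>The subtracted quotient is (2cp)(2cq)/(2c) = 2cpq, exactly the first term of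
      \<open>S\<close>. What remains, 4 times the i-th term, becomes with the factor 1/2 the factor
      2 of the Levi form.\<close>
    have "blinfun_apply ?u (block_vec i) = 2 * ?c * p i" "blinfun_apply ?v (block_vec i) = 2 * ?c * q i"
      by (simp_all only: block_vec_def blinfun.sum_right p q block_vec[OF x[OF i]] block_vec[OF y[OF i]])
    then show ?thesis unfolding S mom_block_vec[OF zN i] using c by simp
  qed
  then have "red_form (mom z) ?u ?v = (1/2) * (\<Sum>i\<in>I. 4 * (coef i z * Re (hblock blk i (radial_field z x) (radial_field z y))))"
    unfolding red_form_def by simp
  also have "\<dots> = levi_kaehler N g lam z (radial_field z x) (radial_field z y)"
    using levi_kaehler_eq[OF zN radial_field_cr_dist[OF zN x] radial_field_cr_dist[OF zN y]] by (simp flip: sum_distrib_left)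
  finally show ?thesis .
qed

text \<open>The equation u(L_s) = weight (p + 2x) is solved for x; summing it over a block and
  requiring zero moment dictates p. The differential at this x has a possibly different
  \<open>q\<close> in place of \<open>p\<close>, and \<open>trans_A_eq_0\<close> shows that the
  difference from u is 0.\<close>

lemma diff_mom_surj:
  assumes z: "z \<in> generic_part N" and u: "u \<in> trans_A \<epsilon>"
  shows "\<exists>x. (\<forall>i\<in>I. mu blk z i x = 0) \<and> diff_on N mom z (radial_field z x) = u"
proof -
  have zN: "z \<in> N" by (rule generic_in_N[OF z])
  define p where "p i = blinfun_apply u (block_vec i) / (2 * coef i z)" for i
  define x where "x = (\<chi> s. (blinfun_apply u (L_axis s) / weight s z - p (blk s)) / 2)"
  have x: "mu blk z i x = 0" if i: "i \<in> I" for i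
  proof -
    have c: "coef i z > 0" by (rule coef_pos[OF zN i])
    have "coef i z * mu blk z i x = (\<Sum>s | blk s = i. (blinfun_apply u (L_axis s) - weight s z * p i) / 2)"
      unfolding mu_def sum_distrib_left
    proof (intro sum.cong refl)
      fix s assume "s \<in> {s. blk s = i}"
      then have "coef i z * ((cmod (z $ s))\<^sup>2 * x $ s) = weight s z * x $ s" by (auto simp: weight_def)
      then show "coef i z * ((cmod (z $ s))\<^sup>2 * x $ s) = (blinfun_apply u (L_axis s) - weight s z * p i) / 2"
        using \<open>s \<in> {s. blk s = i}\<close> weight_pos[OF z, of s] by (simp add: x_def field_simps)
    qed
    also have "\<dots> = (blinfun_apply u (block_vec i) - blinfun_apply (mom z) (block_vec i) * p i) / 2"
      by (simp add: block_vec_def blinfun.sum_right mom_L_axis[OF zN] sum_subtractf flip: sum_divide_distrib sum_distrib_right)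
    also have "\<dots> = 0" using c by (simp add: mom_block_vec[OF zN i] p_def)
    finally show ?thesis using c by simp
  qed
  obtain q where q: "\<And>s. blinfun_apply (diff_on N mom z (radial_field z x)) (L_axis s) = weight s z * (q (blk s) + 2 * x $ s)"
    using diff_on_mom(2)[OF zN x] by blast
  have "diff_on N mom z (radial_field z x) - u = 0"
  proof (rule trans_A_eq_0[OF zN])
    show "diff_on N mom z (radial_field z x) - u \<in> trans_A \<epsilon>"
      using diff_on_mom(1)[OF zN x] u by (simp add: trans_A_def blinfun.diff_left)
    show "blinfun_apply (diff_on N mom z (radial_field z x) - u) (L_axis s) = weight s z * (q (blk s) - p (blk s))" for s
    proof -
      have "x $ s = (blinfun_apply u (L_axis s) / weight s z - p (blk s)) / 2" by (simp add: x_def)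
      then show ?thesis
        using weight_pos[OF z, of s] by (simp add: blinfun.diff_left q field_simps)
    qed
  qed
  then show ?thesis using x by (intro exI[of _ x]) simp
qed

text \<open>Every pair of vectors in the translation space lifts to J(K cap D), so the pullback
  condition leaves no freedom.\<close>

lemma reduced_metric_unique:
  assumes "is_reduced_metric N g lam \<epsilon> L Q" "\<xi> \<in> hmomentum_image N g lam L" "u \<in> trans_A \<epsilon>" "v \<in> trans_A \<epsilon>"
  shows "Q \<xi> u v = red_form \<xi> u v"
proof -
  obtain z where z: "z \<in> generic_part N" "\<xi> = mom z" using assms(2) by (auto simp: hmomentum_image_def)
  obtain x where x: "\<forall>i\<in>I. mu blk z i x = 0" "diff_on N mom z (radial_field z x) = u" using diff_mom_surj[OF z(1) assms(3)] by blast
  obtain y where y: "\<forall>i\<in>I. mu blk z i y = 0" "diff_on N mom z (radial_field z y) = v" using diff_mom_surj[OF z(1) assms(4)] by blast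
  have "radial_field z x \<in> J_orbit_dist N z" "radial_field z y \<in> J_orbit_dist N z"
    using x(1) y(1) by (auto simp: J_orbit_dist_eq[OF generic_in_N[OF z(1)]])
  then have "Q (mom z) (diff_on N mom z (radial_field z x)) (diff_on N mom z (radial_field z y)) = levi_kaehler N g lam z (radial_field z x) (radial_field z y)"
    using assms(1) z(1) unfolding is_reduced_metric_def by blast
  then show ?thesis using red_form_mom[OF z(1), of x y] x y z(2) by simp
qed

text \<open>A lift of \<open>u\<close> is a horizontal vector on which the Levi form is positive.
  The lift is nonzero: with x = 0, the values of \<open>u\<close> would be weights times a function
  of the block, whence u = 0.\<close>

lemma red_form_pos:
  assumes xi: "\<xi> \<in> hmomentum_image N g lam L" and u: "u \<in> trans_A \<epsilon>" "u \<noteq> 0"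
  shows "red_form \<xi> u u > 0"
proof -
  obtain z where z: "z \<in> generic_part N" "\<xi> = mom z" using xi by (auto simp: hmomentum_image_def)
  have zN: "z \<in> N" by (rule generic_in_N[OF z(1)])
  obtain x where x: "\<And>i. i \<in> I \<Longrightarrow> mu blk z i x = 0" "diff_on N mom z (radial_field z x) = u"
    using diff_mom_surj[OF z(1) u(1)] by blast
  have "radial_field z x \<noteq> 0"
  proof
    assume "radial_field z x = 0"
    then have "x $ s = 0" for s using z(1) by (simp add: radial_field_def vec_eq_iff generic_part_def)
    moreover obtain p where "\<And>s. blinfun_apply u (L_axis s) = weight s z * (p (blk s) + 2 * x $ s)"
      using diff_on_mom(2)[OF zN x(1)] x(2) by auto
    ultimately have "u = 0" using trans_A_eq_0[OF zN u(1), of p] by simp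
    with u(2) show False ..
  qed
  then have "levi_kaehler N g lam z (radial_field z x) (radial_field z x) > 0"
    using pos zN radial_field_cr_dist[OF zN x(1)] by (simp add: positive_pair_def)
  then show ?thesis using red_form_mom[OF z(1), of x x] x z(2) by simp
qed

lemma red_form_linear_left: "linear (\<lambda>u. red_form \<xi> u v)"
  by (auto intro!: linearI simp: red_form_def blinfun.add_left blinfun.scaleR_left ring_distribs add_divide_distrib
      sum.distrib sum_subtractf sum_distrib_left mult_ac)

lemma image_positive:
  assumes "\<xi> \<in> hmomentum_image N g lam L"
  shows "blinfun_apply \<xi> (L_axis s) > 0" and "i \<in> I \<Longrightarrow> blinfun_apply \<xi> (block_vec i) > 0"
proof -
  show *: "blinfun_apply \<xi> (L_axis s) > 0" for s using assms by (simp add: mom_image)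
  show "blinfun_apply \<xi> (block_vec i) > 0" if "i \<in> I"
  proof -
    have "{s. blk s = i} \<noteq> {}" using that unfolding range_blk[symmetric] by auto
    then show ?thesis unfolding block_vec_def blinfun.sum_right by (intro sum_pos * finite)
  qed
qed

lemma red_form_smooth: "smooth_fun_on (hmomentum_image N g lam L) V (\<lambda>\<xi>. red_form \<xi> u v)"
proof -
    have *: "red_form \<xi> u v = (\<Sum>i\<in>I. (\<Sum>s | blk s = i. (1/2 * blinfun_apply u (L_axis s) * blinfun_apply v (L_axis s)) * inverse (blinfun_apply \<xi> (L_axis s)) ^ 1)
      + (- 1/2 * blinfun_apply u (block_vec i) * blinfun_apply v (block_vec i)) * inverse (blinfun_apply \<xi> (block_vec i)) ^ 1)" for \<xi>
    unfolding red_form_def sum_distrib_left right_diff_distrib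
    by (intro sum.cong refl) (simp only: divide_inverse power_one_right, simp add: mult_ac)
  show ?thesis
    unfolding smooth_fun_on_def *
    by (intro allI Ck_on_sum Ck_on_add Ck_on_inverse_power) (use image_positive in \<open>auto simp: less_imp_neq[symmetric]\<close>)
qed

lemma openin_image: "openin (top_of_set (affine_A \<epsilon>)) (hmomentum_image N g lam L)"
proof -
  have "open (\<Inter>s\<in>UNIV. {\<xi> :: 'h \<Rightarrow>\<^sub>L real. 0 < blinfun_apply \<xi> (L_axis s)})"
    by (intro open_INT finite ballI open_Collect_less continuous_intros)
  moreover have "hmomentum_image N g lam L = affine_A \<epsilon> \<inter> (\<Inter>s\<in>UNIV. {\<xi> :: 'h \<Rightarrow>\<^sub>L real. 0 < blinfun_apply \<xi> (L_axis s)})"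
    by (auto simp: mom_image)
  ultimately show ?thesis by (auto simp: openin_open)
qed

lemma is_reduced_metric_red_form: "is_reduced_metric N g lam \<epsilon> L red_form"
  unfolding is_reduced_metric_def
proof (intro conjI ballI openin_image)
  show "riemannian_metric_on (hmomentum_image N g lam L) (trans_A \<epsilon>) red_form"
    unfolding riemannian_metric_on_def
  proof (intro conjI ballI allI impI)
    show "red_form \<xi> u v = red_form \<xi> v u" for \<xi> u v by (simp add: red_form_def mult.commute)
  qed (auto simp: linear_add[OF red_form_linear_left] linear_scale[OF red_form_linear_left] red_form_pos red_form_smooth)
  fix z X Y assume z: "z \<in> generic_part N" and "X \<in> J_orbit_dist N z" "Y \<in> J_orbit_dist N z"
  then show "red_form (mom z) (diff_on N mom z X) (diff_on N mom z Y) = levi_kaehler N g lam z X Y"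
    by (auto simp: J_orbit_dist_eq[OF generic_in_N[OF z]] red_form_mom)
qed

end

section \<open>The labelled coordinates\<close>

text \<open>Lagrange's identity with weights \<open>a\<close> and values u/a and v/a, divided by the
  total weight. The product of the sums on the right is the contribution of r = infinity.\<close>

lemma pairwise_form:
  fixes a u v :: "nat \<Rightarrow> real"
  assumes "\<And>r. r \<le> n \<Longrightarrow> a r > 0"
  shows "(\<Sum>(r, s)\<in>{(r, s). r < s \<and> s \<le> n}. a r * a s / (\<Sum>t\<in>{0..n}. a t) *
      ((u r / a r - u s / a s) * (v r / a r - v s / a s))) =
    (\<Sum>r\<in>{0..n}. u r * v r / a r) - (\<Sum>r\<in>{0..n}. u r) * (\<Sum>r\<in>{0..n}. v r) / (\<Sum>r\<in>{0..n}. a r)"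
proof -
  let ?T = "\<Sum>t\<in>{0..n}. a t"
  have T: "?T > 0" using assms by (intro sum_pos) auto
  have u: "(\<Sum>r\<in>{0..n}. a r * (u r / a r)) = (\<Sum>r\<in>{0..n}. u r)"
    and v: "(\<Sum>r\<in>{0..n}. a r * (v r / a r)) = (\<Sum>r\<in>{0..n}. v r)"
    and uv: "(\<Sum>r\<in>{0..n}. a r * (u r / a r) * (v r / a r)) = (\<Sum>r\<in>{0..n}. u r * v r / a r)"
    using assms by (auto intro!: sum.cong simp: less_imp_neq[symmetric])
  have "(\<Sum>(r, s)\<in>{(r, s). r < s \<and> s \<le> n}. a r * a s / ?T * ((u r / a r - u s / a s) * (v r / a r - v s / a s))) =
      (\<Sum>(r, s)\<in>{(r, s). r < s \<and> s \<le> n}. a r * a s * ((u r / a r - u s / a s) * (v r / a r - v s / a s))) / ?T"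
    unfolding sum_divide_distrib by (auto intro!: sum.cong)
  also have "\<dots> = (?T * (\<Sum>r\<in>{0..n}. u r * v r / a r) - (\<Sum>r\<in>{0..n}. u r) * (\<Sum>r\<in>{0..n}. v r)) / ?T"
    unfolding weighted_Lagrange_identity[where L=a and a="\<lambda>r. u r / a r" and b="\<lambda>r. v r / a r"] u v uv ..
  finally show ?thesis using T by (simp add: diff_divide_distrib)
qed

lemma sum_insert_infinity:
  fixes F :: "enat \<Rightarrow> 'a::comm_monoid_add"
  shows "(\<Sum>r\<in>insert \<infinity> (enat ` {0..n}). F r) = F \<infinity> + (\<Sum>r\<in>{0..n}. F (enat r))"
proof -
  have "\<infinity> \<notin> enat ` {0..n}" by auto
  then show ?thesis by (simp add: sum.reindex inj_on_def)
qed

section \<open>From labels (i,r) to blocks of the index type\<close>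

definition block_of :: "nat \<Rightarrow> (nat \<Rightarrow> nat) \<Rightarrow> (nat \<times> nat \<Rightarrow> 's) \<Rightarrow> 's \<Rightarrow> nat" where
  "block_of l m idx s = fst (inv_into (SIGMA i:{1..l}. {0..m i}) idx s)"

context
  fixes l :: nat and m :: "nat \<Rightarrow> nat" and idx :: "nat \<times> nat \<Rightarrow> 's::finite"
  assumes idx: "pair_index l m idx"
begin

lemma inj_idx: "inj_on idx (SIGMA i:{1..l}. {0..m i})"
  and idx_surj: "idx ` (SIGMA i:{1..l}. {0..m i}) = UNIV"
  using idx by (auto simp: pair_index_def bij_betw_def)

lemma block_of_idx: "i \<in> {1..l} \<Longrightarrow> r \<in> {0..m i} \<Longrightarrow> block_of l m idx (idx (i, r)) = i"
  unfolding block_of_def by (subst inv_into_f_f[OF inj_idx]) auto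

lemma block_eq:
  assumes "i \<in> {1..l}"
  shows "{s. block_of l m idx s = i} = (\<lambda>r. idx (i, r)) ` {0..m i}"
proof (intro set_eqI iffI)
  fix s assume s: "s \<in> {s. block_of l m idx s = i}"
  have "s \<in> idx ` (SIGMA i:{1..l}. {0..m i})" using idx_surj by simp
  then obtain j r where "j \<in> {1..l}" "r \<in> {0..m j}" "s = idx (j, r)"
    by (elim imageE SigmaE) simp
  then show "s \<in> (\<lambda>r. idx (i, r)) ` {0..m i}" using s block_of_idx[of j r] by auto
qed (use block_of_idx assms in auto)

lemma sum_block:
  assumes "i \<in> {1..l}"
  shows "(\<Sum>s | block_of l m idx s = i. f s) = (\<Sum>r\<in>{0..m i}. f (idx (i, r)) :: 'a::comm_monoid_add)"
proof -
  have "inj_on (\<lambda>r. idx (i, r)) {0..m i}"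
  proof (rule inj_onI)
    fix r r' assume "r \<in> {0..m i}" "r' \<in> {0..m i}" "idx (i, r) = idx (i, r')"
    then show "r = r'" using inj_onD[OF inj_idx, of "(i, r)" "(i, r')"] assms by simp
  qed
  then show ?thesis unfolding block_eq[OF assms] by (simp add: sum.reindex)
qed

lemma range_block_of: "range (block_of l m idx) = {1..l}"
proof (intro set_eqI iffI)
  fix i assume "i \<in> {1..l}"
  then show "i \<in> range (block_of l m idx)" using block_of_idx[of i 0] by (intro image_eqI[of _ _ "idx (i, 0)"]) simp_all
next
  fix i assume "i \<in> range (block_of l m idx)"
  then obtain s where s: "i = block_of l m idx s" by blast
  have "inv_into (SIGMA i:{1..l}. {0..m i}) idx s \<in> (SIGMA i:{1..l}. {0..m i})"
    using idx_surj by (intro inv_into_into) simp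
  then show "i \<in> {1..l}" unfolding s block_of_def by (elim SigmaE) simp
qed

lemma card_indices: "CARD('s) = (\<Sum>i\<in>{1..l}. m i) + l"
proof -
  have "CARD('s) = card (SIGMA i:{1..l}. {0..m i})"
    using card_image[OF inj_idx] idx_surj by simp
  also have "\<dots> = (\<Sum>i\<in>{1..l}. Suc (m i))" by simp
  finally show ?thesis by (simp add: sum_Suc)
qed

lemma sphere_product_eq: "sphere_product l m idx = block_spheres (block_of l m idx) {1..l}"
proof -
  have "(\<Sum>r\<in>{0..m i}. 1/2 * (cmod (z $ idx (i, r)))\<^sup>2) = 1 \<longleftrightarrow> Re (hblock (block_of l m idx) i z z) = 2"
    if "i \<in> {1..l}" for i z
    unfolding Re_hblock_self sum_block[OF that] by (simp flip: sum_distrib_left sum_divide_distrib)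
  then show ?thesis unfolding sphere_product_def block_spheres_def by blast
qed

end

theorem theorem5:
  fixes l :: nat and m :: "nat \<Rightarrow> nat"
    and idx :: "nat \<times> nat \<Rightarrow> 's::finite"
    and \<epsilon> :: "real \<Rightarrow> 'h::euclidean_space"
    and d :: "'h \<Rightarrow> 't::euclidean_space"
    and L :: "real ^ 's \<Rightarrow> 'h"
    and N :: "(complex ^ 's) set"
    and g :: "(real ^ 's) set" and lam :: "real ^ 's \<Rightarrow> real"
    and U :: "('h \<Rightarrow>\<^sub>L real) set"
  assumes "l \<ge> 1" and "\<And>i. i \<in> {1..l} \<Longrightarrow> m i \<ge> 1"
    and "pair_index l m idx"
    and "linear \<epsilon>" and "inj \<epsilon>" and "linear d" and "surj d" and "range \<epsilon> = {x. d x = 0}"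
    and "DIM('t) = (\<Sum>i\<in>{1..l}. m i)"
    and "linear L" and "surj L"
    and "N = sphere_product l m idx" and "g = pair_g d L" and "lam = pair_lam \<epsilon> L"
    and "acts_transversally N g l"
    and "positive_pair N g lam"
    and "U = hmomentum_image N g lam L"
  shows "symplectic_potential N g lam \<epsilon> L (G_pot L l m idx) \<and>
         (\<forall>\<xi>\<in>U. G_pot L l m idx \<xi> =
           (1/2) * (\<Sum>i\<in>{1..l}. \<Sum>r\<in>{0..m i}.
              blinfun_apply \<xi> (Lvec L m idx i (enat r)) *
              ln \<bar>blinfun_apply \<xi> (Lvec L m idx i (enat r)) / blinfun_apply \<xi> (Lvec L m idx i \<infinity>)\<bar>)) \<and>
         is_reduced_metric N g lam \<epsilon> L (h_red L l m idx) \<and>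
         (\<forall>Q. is_reduced_metric N g lam \<epsilon> L Q \<longrightarrow>
           (\<forall>\<xi>\<in>U. \<forall>u\<in>trans_A \<epsilon>. \<forall>v\<in>trans_A \<epsilon>. Q \<xi> u v = h_red L l m idx \<xi> u v)) \<and>
         (\<forall>\<xi>\<in>U. \<forall>u\<in>trans_A \<epsilon>. \<forall>v\<in>trans_A \<epsilon>. h_red L l m idx \<xi> u v =
           (1/2) * (\<Sum>i\<in>{1..l}. \<Sum>(r, s)\<in>{(r, s). r < s \<and> s \<le> m i}.
              (blinfun_apply \<xi> (Lvec L m idx i (enat r)) * blinfun_apply \<xi> (Lvec L m idx i (enat s))
                 / (\<Sum>t\<in>{0..m i}. blinfun_apply \<xi> (Lvec L m idx i (enat t)))) *
              ((blinfun_apply u (Lvec L m idx i (enat r)) / blinfun_apply \<xi> (Lvec L m idx i (enat r))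
                - blinfun_apply u (Lvec L m idx i (enat s)) / blinfun_apply \<xi> (Lvec L m idx i (enat s))) *
               (blinfun_apply v (Lvec L m idx i (enat r)) / blinfun_apply \<xi> (Lvec L m idx i (enat r))
                - blinfun_apply v (Lvec L m idx i (enat s)) / blinfun_apply \<xi> (Lvec L m idx i (enat s))))))"
proof -
  note lm = assms(1,2) and idx = assms(3)
  let ?blk = "block_of l m idx"
  interpret levi_pair ?blk "{1..l}" N \<epsilon> d L g lam
  proof (rule levi_pair.intro)
    fix i assume i: "i \<in> {1..l}"
    then have "m i \<ge> 1" by (rule lm(2))
    moreover have "idx (i, 0) \<noteq> idx (i, 1)"
      using inj_onD[OF inj_idx[OF idx], of "(i, 0)" "(i, 1)"] i \<open>m i \<ge> 1\<close> by auto
    ultimately show "\<exists>s s'. s \<noteq> s' \<and> ?blk s = i \<and> ?blk s' = i"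
      using block_of_idx[OF idx i, of 0] block_of_idx[OF idx i, of 1] by auto
  qed (use assms range_block_of[OF idx] sphere_product_eq[OF idx] card_indices[OF idx] in simp_all)
  have Lr: "Lvec L m idx i (enat r) = L_axis (idx (i, r))" for i r
    by (simp add: Lvec_def L_axis_def)
  have Linf: "Lvec L m idx i \<infinity> = - block_vec i" if "i \<in> {1..l}" for i
    unfolding Lvec_def block_vec_def sum_block[OF idx that] by (simp add: L_axis_def)
  have block_vec: "(\<Sum>r\<in>{0..m i}. blinfun_apply \<xi> (L_axis (idx (i, r)))) = blinfun_apply \<xi> (block_vec i)" if "i \<in> {1..l}" for i and \<xi> :: "'h \<Rightarrow>\<^sub>L real"
    unfolding block_vec_def blinfun.sum_right sum_block[OF idx that] ..
  have red_form: "h_red L l m idx = red_form"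
  proof (intro ext)
    fix \<xi> u v
    show "h_red L l m idx \<xi> u v = red_form \<xi> u v"
      unfolding h_red_def red_form_def sum_insert_infinity Lr
      by (intro arg_cong[where f="(*) (1/2)"] sum.cong refl)
        (simp add: Linf sum_block[OF idx] blinfun.minus_right)
  qed
  have pos: "blinfun_apply \<xi> (L_axis s) > 0" "i \<in> {1..l} \<Longrightarrow> blinfun_apply \<xi> (block_vec i) > 0" if "\<xi> \<in> U" for \<xi> s i
    using image_positive that assms(17) by auto
  have hess: "has_hessian_on (G_pot L l m idx) (h_red L l m idx) U (trans_A \<epsilon>)"
    unfolding G_pot_def[abs_def] h_red_def[abs_def]
  proof (intro has_hessian_on_cmult has_hessian_on_sum has_hessian_on_x_ln_abs_x)
    \<comment> \<open>Finite r gives a positive value and r = infinity a negative one; the Hessian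
      of x ln |x| covers both signs.\<close>
    fix i r \<xi> assume "i \<in> {1..l}" "r \<in> insert \<infinity> (enat ` {0..m i})" "\<xi> \<in> U"
    then show "blinfun_apply \<xi> (Lvec L m idx i r) \<noteq> 0"
      using pos[of \<xi>] by (auto simp: Lr Linf blinfun.minus_right less_imp_neq[symmetric])
  qed
  have red: "is_reduced_metric N g lam \<epsilon> L (h_red L l m idx)"
    unfolding red_form by (rule is_reduced_metric_red_form)
  have pot: "G_pot L l m idx \<xi> = (1/2) * (\<Sum>i\<in>{1..l}. \<Sum>r\<in>{0..m i}.
      blinfun_apply \<xi> (Lvec L m idx i (enat r)) *
      ln \<bar>blinfun_apply \<xi> (Lvec L m idx i (enat r)) / blinfun_apply \<xi> (Lvec L m idx i \<infinity>)\<bar>)" if xi: "\<xi> \<in> U" for \<xi>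
    unfolding G_pot_def sum_insert_infinity Lr
  proof (intro arg_cong[where f="(*) (1/2)"] sum.cong refl)
    fix i assume i: "i \<in> {1..l}"
    \<comment> \<open>As L_i,infinity is minus the sum of the L_ir, its logarithm distributes over
      the finite r and merges with theirs into logarithms of quotients.\<close>
    have "ln (blinfun_apply \<xi> (L_axis s) / blinfun_apply \<xi> (block_vec i)) = ln (blinfun_apply \<xi> (L_axis s)) - ln (blinfun_apply \<xi> (block_vec i))" for s
      using pos(1)[OF xi, of s] pos(2)[OF xi i] by (simp add: ln_div)
    then show "blinfun_apply \<xi> (Lvec L m idx i \<infinity>) * ln \<bar>blinfun_apply \<xi> (Lvec L m idx i \<infinity>)\<bar> +
        (\<Sum>r = 0..m i. blinfun_apply \<xi> (L_axis (idx (i, r))) * ln \<bar>blinfun_apply \<xi> (L_axis (idx (i, r)))\<bar>) =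
      (\<Sum>r = 0..m i. blinfun_apply \<xi> (L_axis (idx (i, r))) *
        ln \<bar>blinfun_apply \<xi> (L_axis (idx (i, r))) / blinfun_apply \<xi> (Lvec L m idx i \<infinity>)\<bar>)"
      using pos(1)[OF xi] pos(2)[OF xi i] block_vec[OF i, of \<xi>]
      by (simp add: Linf[OF i] blinfun.minus_right abs_of_pos right_diff_distrib sum_subtractf flip: sum_distrib_right)
  qed
  have pairs: "h_red L l m idx \<xi> u v =
           (1/2) * (\<Sum>i\<in>{1..l}. \<Sum>(r, s)\<in>{(r, s). r < s \<and> s \<le> m i}.
              (blinfun_apply \<xi> (Lvec L m idx i (enat r)) * blinfun_apply \<xi> (Lvec L m idx i (enat s))
                 / (\<Sum>t\<in>{0..m i}. blinfun_apply \<xi> (Lvec L m idx i (enat t)))) *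
              ((blinfun_apply u (Lvec L m idx i (enat r)) / blinfun_apply \<xi> (Lvec L m idx i (enat r))
                - blinfun_apply u (Lvec L m idx i (enat s)) / blinfun_apply \<xi> (Lvec L m idx i (enat s))) *
               (blinfun_apply v (Lvec L m idx i (enat r)) / blinfun_apply \<xi> (Lvec L m idx i (enat r))
                - blinfun_apply v (Lvec L m idx i (enat s)) / blinfun_apply \<xi> (Lvec L m idx i (enat s)))))"
    if xi: "\<xi> \<in> U" for \<xi> u v
    unfolding red_form red_form_def Lr
  proof (intro arg_cong[where f="(*) (1/2)"] sum.cong refl)
    fix i assume i: "i \<in> {1..l}"
    show "(\<Sum>s | ?blk s = i. blinfun_apply u (L_axis s) * blinfun_apply v (L_axis s) / blinfun_apply \<xi> (L_axis s)) -
        blinfun_apply u (block_vec i) * blinfun_apply v (block_vec i) / blinfun_apply \<xi> (block_vec i) =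
      (\<Sum>(r, s)\<in>{(r, s). r < s \<and> s \<le> m i}.
        blinfun_apply \<xi> (L_axis (idx (i, r))) * blinfun_apply \<xi> (L_axis (idx (i, s))) / (\<Sum>t = 0..m i. blinfun_apply \<xi> (L_axis (idx (i, t)))) *
        ((blinfun_apply u (L_axis (idx (i, r))) / blinfun_apply \<xi> (L_axis (idx (i, r))) - blinfun_apply u (L_axis (idx (i, s))) / blinfun_apply \<xi> (L_axis (idx (i, s)))) *
         (blinfun_apply v (L_axis (idx (i, r))) / blinfun_apply \<xi> (L_axis (idx (i, r))) - blinfun_apply v (L_axis (idx (i, s))) / blinfun_apply \<xi> (L_axis (idx (i, s))))))"
      unfolding sum_block[OF idx i] block_vec[OF i, symmetric]
      by (rule pairwise_form[symmetric]) (rule pos(1)[OF xi])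
  qed
  have pot_red: "symplectic_potential N g lam \<epsilon> L (G_pot L l m idx)"
    unfolding symplectic_potential_def using red hess[unfolded assms(17)] by (intro exI conjI)
  have unique: "Q \<xi> u v = h_red L l m idx \<xi> u v"
    if "is_reduced_metric N g lam \<epsilon> L Q" "\<xi> \<in> U" "u \<in> trans_A \<epsilon>" "v \<in> trans_A \<epsilon>" for Q \<xi> u v
    unfolding red_form using that unfolding assms(17) by (rule reduced_metric_unique)
  show ?thesis
    by (intro conjI ballI allI impI pot_red red) (erule pot, erule (3) unique, erule pairs)
qed

end
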